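(* Let $y\in C[0,T]$ satisfy the regularity assumption that, for some constant $C_y>0$, $$|y(t)-y(s)|\le C_y(1+t^{\alpha-1})(t-s),\qquad 0\le s<t\le T.$$ Then, for $0\le n\le N_t-1$ and $1\le r\le M$, $$|\partial_t^\alpha y(t_{n,r})-\delta^\alpha y(t_{n,r})|\le C\begin{cases}1,& n=0,\ r=1,\\[2pt](\Delta t)^{1-\alpha}\,t_{0,r}^{\alpha-1},& n=0,\ r\ge2,\\[2pt]\dfrac{M^\alpha}{\Gamma(1-\alpha)},& n=1,\\[6pt](\Delta t)^{1-\alpha}\,T_n^{\alpha-1}M^{\alpha+1},& n\ge2,\end{cases}$$ where $C$ depends only on the function $y$.
   Context: Here $\alpha\in(0,1)$, $T>0$, and $\partial_t^\alpha y(t)=\frac{1}{\Gamma(1-\alpha)}\int_0^t(t-s)^{-\alpha}y'(s)\,ds$ is the Caputo derivative. Grids: coarse nodes $T_n=n\Delta T$, $\Delta T=T/N_t$, $n=0,\dots,N_t$; fine nodes $t_{n,r}=T_n+r\Delta t$, $r=0,\dots,M$, $\Delta t=\Delta T/M$, $M\in\mathbb N$. For real $s\ge0$, $b_s:=(s+1)^{1-\alpha}-s^{1-\alpha}$. The hybrid L1 operator (coarse grid for the history, fine grid on the current interval $[T_n,T_{n+1}]$) is $$\delta^\alpha y(t_{n,r}):=\frac{1}{\Gamma(2-\alpha)}\left((\Delta T)^{-\alpha}\sum_{i=1}^n b_{n-i+r/M}\,(y(T_i)-y(T_{i-1}))+(\Delta t)^{-\alpha}\sum_{j=1}^r b_{r-j}\,(y(t_{n,j})-y(t_{n,j-1}))\right).$$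 *)

theory Defs
  imports "HOL-Analysis.Analysis"
begin

(* Functions on [0,T] are total functions of type real => real whose values outside [0,T] are
   immaterial.  For a function that is merely Lipschitz away from 0, y' exists almost everywhere
   only; deriv is unspecified at the remaining points, which form a null set and so do not
   affect the (Henstock-Kurzweil) integral.  The same holds for the end points 0 and t. *)
definition caputo :: "real \<Rightarrow> (real \<Rightarrow> real) \<Rightarrow> real \<Rightarrow> real" where
  "caputo \<alpha> y t =
     1 / Gamma (1 - \<alpha>) * integral {0..t} (\<lambda>s. (t - s) powr (- \<alpha>) * deriv y s)"

definition coarse_step :: "real \<Rightarrow> nat \<Rightarrow> real" where
  "coarse_step T N = T / real N"

definition fine_step :: "real \<Rightarrow> nat \<Rightarrow> nat \<Rightarrow> real" where
  "fine_step T N M = coarse_step T N / real M"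

definition coarse_node :: "real \<Rightarrow> nat \<Rightarrow> nat \<Rightarrow> real" where
  "coarse_node T N n = real n * coarse_step T N"

definition fine_node :: "real \<Rightarrow> nat \<Rightarrow> nat \<Rightarrow> nat \<Rightarrow> nat \<Rightarrow> real" where
  "fine_node T N M n r = coarse_node T N n + real r * fine_step T N M"

definition L1_weight :: "real \<Rightarrow> real \<Rightarrow> real" where
  "L1_weight \<alpha> s = (s + 1) powr (1 - \<alpha>) - s powr (1 - \<alpha>)"

definition hybrid_L1 ::
    "real \<Rightarrow> real \<Rightarrow> nat \<Rightarrow> nat \<Rightarrow> (real \<Rightarrow> real) \<Rightarrow> nat \<Rightarrow> nat \<Rightarrow> real" where
  "hybrid_L1 \<alpha> T N M y n r =
     1 / Gamma (2 - \<alpha>) *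
     (coarse_step T N powr (- \<alpha>) *
        (\<Sum>i=1..n. L1_weight \<alpha> (real (n - i) + real r / real M) *
           (y (coarse_node T N i) - y (coarse_node T N (i - 1))))
      + fine_step T N M powr (- \<alpha>) *
        (\<Sum>j=1..r. L1_weight \<alpha> (real (r - j)) *
           (y (fine_node T N M n j) - y (fine_node T N M n (j - 1)))))"

end

theory Submission
  imports Defs
begin

text \<open>
  On every cell of the hybrid grid the operator replaces \<open>y'\<close> by the slope of the linear interpolant \<open>p\<close> of \<open>y\<close>:
  the weight \<open>b\<^sub>s\<close> is, up to normalisation, the integral of the kernel \<open>\<phi> s = (t - s)\<^sup>-\<^sup>\<alpha>\<close> over a cell. Hence
  \<open>\<Gamma> (1 - \<alpha>)\<close> times the error is the sum over all cells \<open>[a, b]\<close> of the integral of \<open>\<phi> (y' - p')\<close>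
  (\<open>caputo_minus_hybrid\<close>).

  Cells with \<open>b < t\<close>. The function \<open>y - p\<close> vanishes at both ends and \<open>\<phi>\<close> increases, so by the second
  mean value theorem the cell contributes \<open>(\<phi> a - \<phi> b) (y - p) c\<close> for some \<open>c\<close> in the cell. The growth
  condition bounds \<open>y - p\<close> by \<open>3 L b\<^sup>\<alpha>\<^sup>-\<^sup>1 (b - a)\<close> if the cell starts at \<open>0\<close> or is at most as long as its
  distance to \<open>0\<close>, and every cell of the grid is of one of these kinds (\<open>cell_error_le\<close>).
  The cell \<open>[a, t]\<close> contains the singularity of \<open>\<phi>\<close>; there the two integrals are bounded separately,
  which gives \<open>t\<^sup>\<alpha>\<^sup>-\<^sup>1 (t - a)\<^sup>1\<^sup>-\<^sup>\<alpha>\<close> up to a constant (\<open>last_cell_error_le\<close>).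

  Summation. On a uniform grid from \<open>0\<close> whose distance to \<open>t\<close> is at least one step, with \<open>N - 1\<close>
  cells, the bounds are \<open>i\<^sup>\<alpha>\<^sup>-\<^sup>1 D\<^sub>i\<close> with scaled kernel increments \<open>D\<^sub>i\<close>. For \<open>i \<ge> N/2\<close> the first factor is of
  size \<open>N\<^sup>\<alpha>\<^sup>-\<^sup>1\<close> and the increments telescope; for \<open>i < N/2\<close> the increments are of size \<open>N\<^sup>-\<^sup>\<alpha>\<^sup>-\<^sup>1\<close> and the
  first factors sum to \<open>N\<^sup>\<alpha>\<close>. Either way the total is of size \<open>N\<^sup>\<alpha>\<^sup>-\<^sup>1\<close> (\<open>uniform_grid_sum_le\<close>). This settles the
  first interval, with the fine grid, and for \<open>n \<ge> 1\<close> the history up to \<open>T\<^bsub>n-1\<^esub>\<close>, with the coarse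
  grid. The coarse cell adjacent to the current interval ends at a distance from \<open>t\<close> that can be as small as \<open>\<Delta>t\<close>
  and contributes the factor \<open>M\<^sup>\<alpha>\<close>; the fine cells telescope. So for \<open>n \<ge> 1\<close> the error is at most a constant
  times \<open>n\<^sup>\<alpha>\<^sup>-\<^sup>1 M\<^sup>\<alpha>\<close>, and for \<open>n \<ge> 2\<close> the bound claimed equals \<open>n\<^sup>\<alpha>\<^sup>-\<^sup>1 M\<^sup>2\<^sup>\<alpha>\<close>.

  All this requires that \<open>y'\<close> exists almost everywhere and integrates back to \<open>y\<close>, although the growth
  condition only says that \<open>y\<close> is Lipschitz away from \<open>0\<close>. Differentiability is the one-dimensional
  theorem of Rademacher (\<open>lipschitz_ae_differentiable\<close>), proved by Vitali coverings; the fundamental theorem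
  (\<open>integral_deriv_dominated\<close>) then follows by dominated convergence of difference quotients.
\<close>

section \<open>Almost everywhere differentiability of Lipschitz functions\<close>

text \<open>
  Vitali's covering theorem for balls does not ask that the balls be centred at the points they
  cover. On the line the points may therefore be end points of the covering intervals, as they are for
  one-sided difference quotients.
\<close>

lemma vitali_intervals:
  fixes A U :: "real set"
  assumes "open U" "A \<subseteq> U"
    and fine: "\<And>x d. \<lbrakk>x \<in> A; 0 < d\<rbrakk> \<Longrightarrow> \<exists>u v. u < v \<and> v - u < d \<and> x \<in> {u..v} \<and> R u v"
  obtains C where "countable C" "\<And>u v. (u, v) \<in> C \<Longrightarrow> u < v \<and> {u..v} \<subseteq> U \<and> R u v"
    "disjoint_family_on (\<lambda>(u, v). {u..v}) C"
    "negligible (A - (\<Union>(u, v)\<in>C. {u..v}))"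
proof -
  define K where "K = {(u, v). u < v \<and> {u..v} \<subseteq> U \<and> R u v}"
  define c where "c = (\<lambda>(u, v). (u + v) / 2 :: real)"
  define r where "r = (\<lambda>(u, v). (v - u) / 2 :: real)"
  have cball_K: "cball (c i) (r i) = (case i of (u, v) \<Rightarrow> {u..v})" for i
    by (auto simp: c_def r_def cball_eq_atLeastAtMost field_simps split: prod.splits)
  obtain C where "countable C" "C \<subseteq> K"
    and disj: "pairwise (\<lambda>i j. disjnt (cball (c i) (r i)) (cball (c j) (r j))) C"
    and negl: "negligible (A - (\<Union>i\<in>C. cball (c i) (r i)))"
  proof (rule Vitali_covering_theorem_cballs[of K r A c])
    show "0 < r i" if "i \<in> K" for i
      using that by (auto simp: K_def r_def)
    show "\<exists>i. i \<in> K \<and> x \<in> cball (c i) (r i) \<and> r i < d" if "x \<in> A" "0 < d" for x d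
    proof -
      obtain e where "e > 0" "ball x e \<subseteq> U"
        using assms \<open>x \<in> A\<close> by (meson openE subsetD)
      obtain u v where uv: "u < v" "v - u < min d e" "x \<in> {u..v}" "R u v"
        using fine[of x "min d e"] \<open>x \<in> A\<close> \<open>0 < d\<close> \<open>e > 0\<close> by auto
      then have "{u..v} \<subseteq> ball x e"
        by (auto simp: dist_real_def)
      then have "(u, v) \<in> K"
        using uv \<open>ball x e \<subseteq> U\<close> by (auto simp: K_def)
      moreover have "r (u, v) < d"
        using uv by (auto simp: r_def)
      ultimately show ?thesis
        using uv cball_K by (intro exI[of _ "(u, v)"]) auto
    qed
  qed
  show ?thesis
  proof
    show "countable C" by fact
    show "u < v \<and> {u..v} \<subseteq> U \<and> R u v" if "(u, v) \<in> C" for u v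
      using that \<open>C \<subseteq> K\<close> by (auto simp: K_def)
    show "disjoint_family_on (\<lambda>(u, v). {u..v}) C"
      using disj unfolding cball_K by (auto simp: disjoint_family_on_def pairwise_def disjnt_def)
    show "negligible (A - (\<Union>(u, v)\<in>C. {u..v}))"
      using negl unfolding cball_K .
  qed
qed

text \<open>
  Compare Lebesgue measure with the Stieltjes measure \<open>\<mu>\<close> of \<open>F\<close>. Almost all of \<open>A\<close> is covered by
  disjoint intervals of slope at most \<open>p\<close> inside a given open \<open>U\<close>, so their union has \<open>\<mu>\<close>-measure at
  most \<open>p\<close> times the length of \<open>U\<close>. Inside these intervals almost all of \<open>A\<close> is covered again, by disjoint
  intervals of slope at least \<open>q\<close>, so that union has \<open>\<mu>\<close>-measure at least \<open>q\<close> times the length of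
  \<open>A\<close>. Letting \<open>U\<close> shrink to \<open>A\<close> gives \<open>q\<close> times the length \<open>\<le> p\<close> times the length.
\<close>

lemma small_and_large_slopes_negligible:
  fixes F :: "real \<Rightarrow> real"
  assumes mono: "\<And>x y. x \<le> y \<Longrightarrow> F x \<le> F y" and cont: "continuous_on UNIV F"
    and pq: "0 < p" "p < q"
    and A: "A \<in> sets borel" "A \<subseteq> {a..b}"
    and small: "\<And>x d. \<lbrakk>x \<in> A; 0 < d\<rbrakk> \<Longrightarrow>
                  \<exists>u v. u < v \<and> v - u < d \<and> x \<in> {u..v} \<and> F v - F u \<le> p * (v - u)"
    and large: "\<And>x d. \<lbrakk>x \<in> A; 0 < d\<rbrakk> \<Longrightarrow>
                  \<exists>u v. u < v \<and> v - u < d \<and> x \<in> {u..v} \<and> q * (v - u) \<le> F v - F u"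
  shows "negligible A"
proof -
  define \<mu> where "\<mu> = interval_measure F"
  have [measurable_cong]: "sets \<mu> = sets borel" by (simp add: \<mu>_def)
  have \<mu>_Icc: "emeasure \<mu> {u..v} = ennreal (F v - F u)" if "u \<le> v" for u v
    unfolding \<mu>_def using that by (intro emeasure_interval_measure_Icc mono cont) auto
  have growth: "ennreal q * emeasure lborel A \<le> ennreal p * emeasure lborel U"
    if U: "open U" "A \<subseteq> U" for U
  proof -
    obtain C where C: "countable C"
        "\<And>u v. (u, v) \<in> C \<Longrightarrow> u < v \<and> {u..v} \<subseteq> U \<and> F v - F u \<le> p * (v - u)"
        "disjoint_family_on (\<lambda>(u, v). {u..v}) C"
        "negligible (A - (\<Union>(u, v)\<in>C. {u..v}))"
      using vitali_intervals[OF U, of "\<lambda>u v. F v - F u \<le> p * (v - u)"] small by metis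
    define V where "V = (\<Union>(u, v)\<in>C. {u<..<v})"
    have "open V" unfolding V_def by auto
    obtain D where D: "countable D"
        "\<And>u v. (u, v) \<in> D \<Longrightarrow> u < v \<and> {u..v} \<subseteq> V \<and> q * (v - u) \<le> F v - F u"
        "disjoint_family_on (\<lambda>(u, v). {u..v}) D"
        "negligible (A \<inter> V - (\<Union>(u, v)\<in>D. {u..v}))"
      using vitali_intervals[of V "A \<inter> V" "\<lambda>u v. q * (v - u) \<le> F v - F u"] large \<open>open V\<close>
      by (metis Int_iff inf.cobounded2)
    let ?C = "\<Union>(u, v)\<in>C. {u..v}" and ?D = "\<Union>(u, v)\<in>D. {u..v}"
    have meas: "?C \<in> sets borel" "?D \<in> sets borel"
      using C(1) D(1) by (auto intro!: sets.countable_UN')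
    \<comment> \<open>The second covering lives in the open intervals, which miss countably many end points.\<close>
    have "A - ?D \<subseteq> (A - ?C) \<union> (A \<inter> V - ?D) \<union> (fst ` C \<union> snd ` C)"
      by (force simp: V_def)
    moreover have "negligible (fst ` C \<union> snd ` C)"
      using C(1) by (auto simp: negligible_iff_null_sets intro!: null_sets_completionI
                     countable_imp_null_set_lborel)
    ultimately have "negligible (A - ?D)"
      using C(4) D(4) by (meson negligible_Un negligible_subset)
    then have null: "emeasure lborel (A - ?D) = 0"
      using A(1) meas(2) by (simp add: negligible_iff_null_sets null_sets_def)
    have "emeasure lborel A \<le> emeasure lborel ((A - ?D) \<union> ?D)"
      using A(1) meas by (intro emeasure_mono) auto
    also have "\<dots> \<le> emeasure lborel (A - ?D) + emeasure lborel ?D"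
      using A(1) meas by (intro emeasure_subadditive) auto
    finally have "emeasure lborel A \<le> emeasure lborel ?D"
      by (simp add: null)
    then have "ennreal q * emeasure lborel A \<le> ennreal q * emeasure lborel ?D"
      by (rule mult_left_mono) auto
    also have "\<dots> = (\<integral>\<^sup>+i. ennreal q * emeasure lborel (case i of (u, v) \<Rightarrow> {u..v}) \<partial>count_space D)"
      using D(1,3) by (subst emeasure_UN_countable) (auto simp: nn_integral_cmult)
    also have "\<dots> \<le> (\<integral>\<^sup>+i. emeasure \<mu> (case i of (u, v) \<Rightarrow> {u..v}) \<partial>count_space D)"
    proof (intro nn_integral_mono, clarsimp)
      fix u v assume "(u, v) \<in> D"
      with D(2)[OF this] pq show "ennreal q * emeasure lborel {u..v} \<le> emeasure \<mu> {u..v}"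
        by (simp add: \<mu>_Icc ennreal_mult[symmetric] ennreal_leI)
    qed
    also have "\<dots> = emeasure \<mu> ?D"
      using D(1,3) by (subst emeasure_UN_countable) auto
    also have "\<dots> \<le> emeasure \<mu> ?C"
    proof (rule emeasure_mono)
      have "V \<subseteq> ?C" unfolding V_def by (intro UN_mono) auto
      with D(2) show "?D \<subseteq> ?C" by blast
      show "?C \<in> sets \<mu>" using meas by (simp add: \<mu>_def)
    qed
    also have "\<dots> = (\<integral>\<^sup>+i. emeasure \<mu> (case i of (u, v) \<Rightarrow> {u..v}) \<partial>count_space C)"
      using C(1,3) by (subst emeasure_UN_countable) auto
    also have "\<dots> \<le> (\<integral>\<^sup>+i. ennreal p * emeasure lborel (case i of (u, v) \<Rightarrow> {u..v}) \<partial>count_space C)"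
    proof (intro nn_integral_mono, clarsimp)
      fix u v assume "(u, v) \<in> C"
      with C(2)[OF this] pq show "emeasure \<mu> {u..v} \<le> ennreal p * emeasure lborel {u..v}"
        by (simp add: \<mu>_Icc ennreal_mult[symmetric] ennreal_leI)
    qed
    also have "\<dots> = ennreal p * emeasure lborel ?C"
      using C(1,3) by (subst emeasure_UN_countable) (auto simp: nn_integral_cmult)
    also have "\<dots> \<le> ennreal p * emeasure lborel U"
    proof (intro mult_left_mono emeasure_mono)
      show "?C \<subseteq> U" using C(2) by blast
    qed (use U(1) in auto)
    finally show ?thesis .
  qed
  have "emeasure lborel A \<le> emeasure lborel {a..b}"
    using A by (intro emeasure_mono) auto
  also have "\<dots> < \<infinity>" by (simp add: emeasure_lborel_Icc_eq)
  finally obtain m where m: "emeasure lborel A = ennreal m" "0 \<le> m"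
    by (metis ennreal_cases infinity_ennreal_def less_irrefl)
  have "q * m \<le> p * m + p * e" if "0 < e" for e
  proof -
    obtain U where U: "open U" "A \<subseteq> U" "emeasure lborel (U - A) < ennreal e"
      using outer_regular_lborel[OF A(1) \<open>0 < e\<close>] by blast
    have "emeasure lborel U \<le> emeasure lborel (A \<union> (U - A))"
      using A(1) U(1) by (intro emeasure_mono) auto
    also have "\<dots> \<le> emeasure lborel A + emeasure lborel (U - A)"
      using A(1) U(1) by (intro emeasure_subadditive) auto
    also have "\<dots> \<le> ennreal (m + e)"
      using U(3) m \<open>0 < e\<close> by (simp add: add_left_mono less_imp_le)
    finally have "ennreal p * emeasure lborel U \<le> ennreal p * ennreal (m + e)"
      by (rule mult_left_mono) simp
    then have "ennreal q * ennreal m \<le> ennreal p * ennreal (m + e)"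
      using growth[OF U(1,2)] unfolding m(1) by (rule order_trans[rotated])
    then have "q * m \<le> p * (m + e)"
      using pq m that by (simp add: ennreal_mult[symmetric] ennreal_le_iff del: ennreal_plus)
    then show ?thesis by (simp add: distrib_left)
  qed
  note approx = this
  have "q * m \<le> p * m"
  proof (rule field_le_epsilon)
    fix e :: real assume "0 < e"
    then show "q * m \<le> p * m + e"
      using approx[of "e / p"] pq by simp
  qed
  then have "m = 0"
    using pq m(2) by (simp add: mult_le_cancel_right)
  then show ?thesis
    using m A(1) by (simp add: negligible_iff_null_sets null_sets_def)
qed

text \<open>
  The limit is the supremum of the eventual lower bounds of \<open>Q\<close>. Only rational levels are tested,
  because divergence of difference quotients is to be split into countably many cases.
\<close>

lemma convergent_if_no_two_levels:
  fixes Q :: "'a \<Rightarrow> real"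
  assumes nt: "G \<noteq> bot"
    and bounds: "\<forall>\<^sub>F h in G. 0 \<le> Q h" "\<forall>\<^sub>F h in G. Q h \<le> B"
    and levels: "\<And>p q. \<lbrakk>p \<in> \<rat>; q \<in> \<rat>; 0 < p; p < q\<rbrakk> \<Longrightarrow>
                   (\<forall>\<^sub>F h in G. p \<le> Q h) \<or> (\<forall>\<^sub>F h in G. Q h \<le> q)"
  obtains l where "(Q \<longlongrightarrow> l) G"
proof
  define S where "S = {p. \<forall>\<^sub>F h in G. p \<le> Q h}"
  have S_le: "p \<le> B" if "p \<in> S" for p
  proof -
    have "\<forall>\<^sub>F h in G. p \<le> B"
      using that bounds(2) unfolding S_def mem_Collect_eq by eventually_elim auto
    with nt show ?thesis by simp
  qed
  then have S: "0 \<in> S" "bdd_above S"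
    using bounds(1) by (auto simp: S_def bdd_above_def)
  then have "0 \<le> Sup S" by (rule cSup_upper)
  show "(Q \<longlongrightarrow> Sup S) G"
  proof (rule order_tendstoI)
    fix c assume "c < Sup S"
    then obtain p where "p \<in> S" "c < p"
      using S less_cSup_iff[of S c] by blast
    then show "\<forall>\<^sub>F h in G. c < Q h"
      unfolding S_def by (auto elim: eventually_mono)
  next
    fix c assume "Sup S < c"
    obtain p where p: "p \<in> \<rat>" "Sup S < p" "p < c"
      using Rats_dense_in_real[OF \<open>Sup S < c\<close>] by blast
    obtain q where q: "q \<in> \<rat>" "p < q" "q < c"
      using Rats_dense_in_real[OF \<open>p < c\<close>] by blast
    have "p \<notin> S"
      using p(2) S cSup_upper[of p S] by auto
    then have "\<forall>\<^sub>F h in G. Q h \<le> q"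
      using levels[OF p(1) q(1)] p q \<open>0 \<le> Sup S\<close> by (auto simp: S_def)
    then show "\<forall>\<^sub>F h in G. Q h < c"
      by (rule eventually_mono) (use q in auto)
  qed
qed

text \<open>
  Where \<open>F\<close> is not differentiable, the difference quotients drop below some rational \<open>p\<close> and rise above some
  rational \<open>q > p\<close> arbitrarily close to the point. For fixed \<open>p\<close> and \<open>q\<close> these points form a
  countable intersection of open sets, as \<open>F\<close> is continuous and the inequalities are strict, so the
  set is Borel and the slope comparison applies.
\<close>

lemma mono_lipschitz_ae_differentiable:
  fixes F :: "real \<Rightarrow> real"
  assumes mono: "\<And>x y. x \<le> y \<Longrightarrow> F x \<le> F y"
    and lip: "B-lipschitz_on UNIV F"
  shows "negligible {x\<in>{a<..<b}. \<not> F differentiable (at x)}"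
proof -
  have cont: "continuous_on UNIV F"
    using lip by (rule lipschitz_on_continuous_on)
  define Q where "Q = (\<lambda>x h. (F (x + h) - F x) / h)"
  \<comment> \<open>The point \<open>x\<close> has a difference quotient satisfying \<open>P\<close> with a step shorter than \<open>d\<close>.\<close>
  define near where "near = (\<lambda>P x d. \<exists>h. h \<noteq> 0 \<and> \<bar>h\<bar> < d \<and> P (Q x h) :: bool)"
  define A where "A = (\<lambda>p q. {x\<in>{a<..<b}. \<forall>k. near (\<lambda>s. s < p) x (inverse (Suc k))
                                      \<and> near (\<lambda>s. q < s) x (inverse (Suc k))})"
  have cont_Q: "continuous_on UNIV (\<lambda>x. Q x h)" if "h \<noteq> 0" for h
    unfolding Q_def using that
    by (intro continuous_intros continuous_on_compose2[OF cont]) auto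
  have open_near: "open {x. near P x d}" if "open {s. P s}" for P d
  proof -
    have "{x. near P x d} = (\<Union>h\<in>{h. h \<noteq> 0 \<and> \<bar>h\<bar> < d}. (\<lambda>x. Q x h) -` {s. P s})"
      by (auto simp: near_def)
    then show ?thesis
      using that cont_Q by (auto simp del: vimage_Collect_eq intro!: open_UN open_vimage)
  qed
  have A_borel: "A p q \<in> sets borel" for p q
  proof -
    have "A p q = {a<..<b} \<inter> (\<Inter>k. {x. near (\<lambda>s. s < p) x (inverse (Suc k))}
                                  \<inter> {x. near (\<lambda>s. q < s) x (inverse (Suc k))})"
      by (auto simp: A_def)
    also have "\<dots> \<in> sets borel"
      by (intro sets.Int sets.countable_INT'' borel_open open_near)
         (auto intro!: open_Collect_less continuous_intros)
    finally show ?thesis .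
  qed
  have near_slope: "\<exists>u v. u < v \<and> v - u < d \<and> x \<in> {u..v} \<and> P ((F v - F u) / (v - u))"
    if P_near: "\<forall>k. near P x (inverse (Suc k))" and "0 < d" for P x d
  proof -
    obtain k where k: "inverse (Suc k) < d"
      using reals_Archimedean \<open>0 < d\<close> by blast
    obtain h where h: "h \<noteq> 0" "\<bar>h\<bar> < inverse (Suc k)" "P (Q x h)"
      using spec[OF P_near, of k] by (auto simp: near_def)
    show ?thesis
    proof (cases "0 < h")
      case True
      with h k show ?thesis
        by (intro exI[of _ x] exI[of _ "x + h"]) (auto simp: Q_def)
    next
      case False
      have "Q x h = (F x - F (x + h)) / (x - (x + h))"
        by (simp add: Q_def minus_divide_left minus_divide_right)
      with False h k show ?thesis
        by (intro exI[of _ "x + h"] exI[of _ x]) auto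
    qed
  qed
  have "negligible (A p q)" if "0 < p" "p < q" for p q
  proof (rule small_and_large_slopes_negligible[OF mono cont that A_borel])
    show "A p q \<subseteq> {a..b}" by (auto simp: A_def)
    fix x d :: real assume x: "x \<in> A p q" "0 < d"
    show "\<exists>u v. u < v \<and> v - u < d \<and> x \<in> {u..v} \<and> F v - F u \<le> p * (v - u)"
      using near_slope[of "\<lambda>s. s < p" x d] x by (fastforce simp: A_def pos_divide_less_eq)
    show "\<exists>u v. u < v \<and> v - u < d \<and> x \<in> {u..v} \<and> q * (v - u) \<le> F v - F u"
      using near_slope[of "\<lambda>s. q < s" x d] x by (fastforce simp: A_def pos_less_divide_eq)
  qed
  then have "negligible (\<Union>(p, q)\<in>{(p, q). p \<in> \<rat> \<and> q \<in> \<rat> \<and> 0 < p \<and> p < q}. A p q)"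
    by (intro negligible_countable_Union countable_image
          countable_subset[OF _ countable_SIGMA[OF countable_rat countable_rat]]) auto
  then show ?thesis
  proof (rule negligible_subset, safe)
    fix x assume x: "x \<in> {a<..<b}" "\<not> F differentiable (at x)"
    have "\<exists>p q. p \<in> \<rat> \<and> q \<in> \<rat> \<and> 0 < p \<and> p < q \<and> x \<in> A p q"
    proof (rule ccontr)
      assume none: "\<not> ?thesis"
      have "\<exists>l. (Q x \<longlongrightarrow> l) (at 0)"
      proof (rule convergent_if_no_two_levels[of "at 0" "Q x" B])
        have Q_bounds: "0 \<le> Q x h \<and> Q x h \<le> B" if "h \<noteq> 0" for h
        proof -
          have "dist (F (x + h)) (F x) \<le> B * dist (x + h) x"
            by (rule lipschitz_onD[OF lip]) auto
          then have "\<bar>F (x + h) - F x\<bar> \<le> B * \<bar>h\<bar>" by (simp add: dist_real_def)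
          then have "\<bar>Q x h\<bar> \<le> B"
            using that by (simp add: Q_def pos_divide_le_eq)
          moreover have "0 \<le> Q x h"
            using that mono[of x "x + h"] mono[of "x + h" x]
            by (cases "0 < h") (auto simp: Q_def zero_le_divide_iff)
          ultimately show ?thesis by auto
        qed
        show "\<forall>\<^sub>F h in at 0. 0 \<le> Q x h" "\<forall>\<^sub>F h in at 0. Q x h \<le> B"
          using Q_bounds by (auto simp: eventually_at_filter)
        fix p q :: real assume pq: "p \<in> \<rat>" "q \<in> \<rat>" "0 < p" "p < q"
        then have "x \<notin> A p q" using none by blast
        then obtain k where "\<not> near (\<lambda>s. s < p) x (inverse (Suc k))
                            \<or> \<not> near (\<lambda>s. q < s) x (inverse (Suc k))"
          using x(1) by (auto simp: A_def)
        moreover have "\<forall>\<^sub>F h in at 0. \<not> P (Q x h)" if "\<not> near P x (inverse (Suc k))" for P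
          unfolding eventually_at
          by (rule exI[of _ "inverse (Suc k)"]) (use that in \<open>auto simp: near_def\<close>)
        ultimately have "(\<forall>\<^sub>F h in at 0. \<not> Q x h < p) \<or> (\<forall>\<^sub>F h in at 0. \<not> q < Q x h)"
          by auto
        then show "(\<forall>\<^sub>F h in at 0. p \<le> Q x h) \<or> (\<forall>\<^sub>F h in at 0. Q x h \<le> q)"
          by (simp add: not_less)
      qed auto
      then obtain l where "(Q x \<longlongrightarrow> l) (at 0)" by blast
      then have "DERIV F x :> l"
        by (simp add: Q_def DERIV_def)
      with x(2) show False
        using real_differentiable_def by blast
    qed
    then show "x \<in> (\<Union>(p, q)\<in>{(p, q). p \<in> \<rat> \<and> q \<in> \<rat> \<and> 0 < p \<and> p < q}. A p q)"
      by blast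
  qed
qed

text \<open>
  Clamping the argument to \<open>{a..b}\<close> extends \<open>f\<close> to the line with the same constant, and adding \<open>L x\<close> makes
  it increasing; neither affects differentiability at interior points.
\<close>

theorem lipschitz_ae_differentiable:
  fixes f :: "real \<Rightarrow> real"
  assumes lip: "L-lipschitz_on {a..b} f"
  shows "negligible {x\<in>{a<..<b}. \<not> f differentiable (at x)}"
proof (cases "a \<le> b")
  case True
  define g where "g = (\<lambda>x. f (max a (min b x)))"
  have "0 \<le> L" using lip by (rule lipschitz_on_nonneg)
  have g: "\<bar>g x - g y\<bar> \<le> L * \<bar>x - y\<bar>" for x y
  proof -
    have "\<bar>g x - g y\<bar> \<le> L * \<bar>max a (min b x) - max a (min b y)\<bar>"
      using lipschitz_onD[OF lip, of "max a (min b x)" "max a (min b y)"] True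
      by (auto simp: g_def dist_real_def)
    also have "\<dots> \<le> L * \<bar>x - y\<bar>"
      using \<open>0 \<le> L\<close> by (intro mult_left_mono) auto
    finally show ?thesis .
  qed
  define F where "F = (\<lambda>x. g x + L * x)"
  have "negligible {x\<in>{a<..<b}. \<not> F differentiable (at x)}"
  proof (rule mono_lipschitz_ae_differentiable)
    show "F x \<le> F y" if "x \<le> y" for x y
      using g[of x y] that by (auto simp: F_def algebra_simps)
    show "(2 * L)-lipschitz_on UNIV F"
    proof (rule lipschitz_onI)
      show "dist (F x) (F y) \<le> 2 * L * dist x y" for x y
      proof -
        have "\<bar>F x - F y\<bar> \<le> \<bar>g x - g y\<bar> + \<bar>L * (x - y)\<bar>"
          by (auto simp: F_def algebra_simps)
        also have "\<dots> \<le> L * \<bar>x - y\<bar> + L * \<bar>x - y\<bar>"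
          using g[of x y] \<open>0 \<le> L\<close> by (simp add: abs_mult)
        finally show ?thesis by (simp add: dist_real_def)
      qed
    qed (use \<open>0 \<le> L\<close> in auto)
  qed
  then show ?thesis
  proof (rule negligible_subset, safe)
    fix x assume x: "x \<in> {a<..<b}" "\<not> f differentiable (at x)" "F differentiable (at x)"
    obtain D where "DERIV F x :> D"
      using x(3) by (auto simp: real_differentiable_def)
    then have "DERIV (\<lambda>x. F x - L * x) x :> D - L"
      by (auto intro!: derivative_eq_intros)
    then have "DERIV f x :> D - L"
      by (rule has_field_derivative_transform_within_open[where S = "{a<..<b}"])
         (use x(1) in \<open>auto simp: F_def g_def\<close>)
    then have "f differentiable (at x)"
      using real_differentiable_def by blast
    with x(2) show False by blast
  qed
qed auto

section \<open>The fundamental theorem of calculus under a dominated difference quotient\<close>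

text \<open>
  The integral of a difference quotient of step \<open>h\<close> is the difference between the means of \<open>F\<close> over an
  interval of length \<open>h\<close> next to \<open>b\<close> and one next to \<open>a\<close>, hence tends to \<open>F b - F a\<close>. The
  difference quotients converge to the derivative almost everywhere, and \<open>g\<close> dominates them. The bound
  \<open>g x\<close> concerns forward quotients at \<open>x\<close> only, which leaves room for a singularity of \<open>g\<close> at \<open>a\<close>.
\<close>

lemma integral_deriv_dominated:
  fixes F g :: "real \<Rightarrow> real"
  assumes "a < b" and cont: "continuous_on {a..b} F"
    and diff: "negligible {x\<in>{a<..<b}. \<not> F differentiable (at x)}"
    and g: "g integrable_on {a..b}"
    and dom: "\<And>x z. \<lbrakk>a < x; x < z; z \<le> b\<rbrakk> \<Longrightarrow> \<bar>F z - F x\<bar> \<le> g x * (z - x)"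
  shows "(deriv F has_integral F b - F a) {a..b}"
proof -
  \<comment> \<open>Difference quotients near \<open>b\<close> reach beyond \<open>b\<close>, where \<open>F\<close> is continued by the constant \<open>F b\<close>.\<close>
  define G where "G = (\<lambda>x. F (max a (min b x)))"
  have cont_G: "continuous_on S G" for S
    unfolding G_def using \<open>a < b\<close>
    by (intro continuous_on_compose2[OF cont] continuous_intros) auto
  define h where "h = (\<lambda>k. inverse (real (Suc k)))"
  have h: "0 < h k" "h k \<le> 1" for k
    by (auto simp: h_def field_simps)
  have h_lim: "h \<longlonglongrightarrow> 0"
    unfolding h_def by (rule LIMSEQ_inverse_real_of_nat)
  define D where "D = (\<lambda>k x. (G (x + h k) - G x) / h k)"
  define P where "P = (\<lambda>u. integral {a..u} G)"
  have P_lim: "(\<lambda>k. (P (c + h k) - P c) / h k) \<longlonglongrightarrow> F c" if "c \<in> {a, b}" for c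
  proof -
    have "(P has_real_derivative G c) (at c within {a..b+1})"
      unfolding P_def using that \<open>a < b\<close> by (intro integral_has_real_derivative cont_G) auto
    then have "((\<lambda>x. (P x - P c) / (x - c)) \<longlongrightarrow> G c) (at c within {a..b+1})"
      by (simp add: has_field_derivative_iff)
    moreover have "filterlim (\<lambda>k. c + h k) (at c within {a..b+1}) sequentially"
    proof -
      have "(\<lambda>k. c + h k) \<longlonglongrightarrow> c"
        using tendsto_add[OF tendsto_const h_lim, of c] by simp
      moreover have "c + h k \<in> {a..b+1} \<and> c + h k \<noteq> c" for k
        using h[of k] that \<open>a < b\<close> by auto
      ultimately show ?thesis
        by (auto simp: filterlim_at)
    qed
    ultimately have "(\<lambda>k. (P (c + h k) - P c) / (c + h k - c)) \<longlonglongrightarrow> G c"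
      by (rule filterlim_compose)
    moreover have "G c = F c" using that \<open>a < b\<close> by (auto simp: G_def)
    ultimately show ?thesis by simp
  qed
  have P_diff: "integral {u..v} G = P v - P u" if "a \<le> u" "u \<le> v" for u v
    unfolding P_def using that
    by (subst Henstock_Kurzweil_Integration.integral_combine[of a u v G, symmetric])
       (auto intro: integrable_continuous_real cont_G)
  have int_D: "(D k has_integral ((P (b + h k) - P b) / h k - (P (a + h k) - P a) / h k)) {a..b}" for k
  proof -
    have "((G \<circ> (+) (h k)) has_integral (P (b + h k) - P (a + h k))) {a..b}"
      unfolding has_integral_shift_Icc_real
      using P_diff[of "a + h k" "b + h k"] h[of k] \<open>a < b\<close>
      by (metis add_increasing2 add_le_cancel_right cont_G integrable_continuous_real
            integrable_integral less_imp_le order_refl)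
    moreover have "(G has_integral (P b - P a)) {a..b}"
      using P_diff[of a b] \<open>a < b\<close>
      by (metis cont_G integrable_continuous_real integrable_integral less_imp_le order_refl)
    ultimately have "((\<lambda>x. ((G \<circ> (+) (h k)) x - G x) / h k) has_integral
        ((P (b + h k) - P (a + h k)) - (P b - P a)) / h k) {a..b}"
      by (intro has_integral_divide has_integral_diff)
    then show ?thesis
      by (simp add: D_def[abs_def] o_def add.commute diff_divide_distrib add_divide_distrib algebra_simps)
  qed
  define N where "N = {x\<in>{a<..<b}. \<not> F differentiable (at x)}"
  have sub: "{a<..<b} - N \<subseteq> {a..b}" "negligible ({a..b} - ({a<..<b} - N))"
  proof -
    have "{a..b} - ({a<..<b} - N) \<subseteq> insert a (insert b N)" by auto
    then show "negligible ({a..b} - ({a<..<b} - N))"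
      using diff unfolding N_def[symmetric] by (meson negligible_insert negligible_subset)
  qed auto
  have spike: "(f has_integral I) ({a<..<b} - N) \<longleftrightarrow> (f has_integral I) {a..b}" for f :: "real \<Rightarrow> real" and I
    using sub by (intro has_integral_spike_set_eq) (auto intro: negligible_subset)
  have "(deriv F has_integral (F b - F a)) ({a<..<b} - N)"
  proof (rule has_integral_dominated_convergence[where f = D and h = g])
    show "(D k has_integral ((P (b + h k) - P b) / h k - (P (a + h k) - P a) / h k)) ({a<..<b} - N)" for k
      using int_D by (simp add: spike)
    show "g integrable_on {a<..<b} - N"
      using g spike by (auto simp: integrable_on_def)
    show "\<forall>x\<in>{a<..<b} - N. norm (D k x) \<le> g x" for k
    proof
      fix x assume "x \<in> {a<..<b} - N"
      then have x: "a < x" "x < b" by auto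
      have "0 \<le> g x"
        using dom[of x b] x by (smt (verit) zero_le_mult_iff)
      have "\<bar>G (x + h k) - G x\<bar> = \<bar>F (min b (x + h k)) - F x\<bar>"
        using x h[of k] by (auto simp: G_def max_def min_def)
      also have "\<dots> \<le> g x * (min b (x + h k) - x)"
        using x h[of k] by (intro dom) auto
      also have "\<dots> \<le> g x * h k"
        using \<open>0 \<le> g x\<close> by (intro mult_left_mono) auto
      finally show "norm (D k x) \<le> g x"
        using h[of k] by (simp add: D_def pos_divide_le_eq)
    qed
    show "\<forall>x\<in>{a<..<b} - N. (\<lambda>k. D k x) \<longlonglongrightarrow> deriv F x"
    proof
      fix x assume "x \<in> {a<..<b} - N"
      then have x: "a < x" "x < b" "F differentiable (at x)" by (auto simp: N_def)
      then have "DERIV F x :> deriv F x"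
        using DERIV_deriv_iff_real_differentiable by blast
      then have "((\<lambda>s. (F (x + s) - F x) / s) \<longlongrightarrow> deriv F x) (at 0)"
        by (simp add: DERIV_def)
      moreover have "filterlim h (at 0) sequentially"
        using h_lim h(1) by (auto simp: filterlim_at less_imp_neq[symmetric])
      ultimately have "(\<lambda>k. (F (x + h k) - F x) / h k) \<longlonglongrightarrow> deriv F x"
        by (rule filterlim_compose)
      moreover have "\<forall>\<^sub>F k in sequentially. h k < b - x"
        using h_lim x by (intro order_tendstoD(2)) auto
      then have "\<forall>\<^sub>F k in sequentially. (F (x + h k) - F x) / h k = D k x"
      proof eventually_elim
        case (elim k)
        with x h[of k] show ?case
          by (simp add: D_def G_def max_def min_def)
      qed
      ultimately show "(\<lambda>k. D k x) \<longlonglongrightarrow> deriv F x"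
        by (rule Lim_transform_eventually)
    qed
    show "(\<lambda>k. (P (b + h k) - P b) / h k - (P (a + h k) - P a) / h k) \<longlonglongrightarrow> F b - F a"
      using P_lim by (intro tendsto_diff) auto
  qed
  then show ?thesis by (simp add: spike)
qed

lemma abs_deriv_le:
  fixes f :: "real \<Rightarrow> real"
  assumes "f differentiable (at x)" "x < b"
    and le: "\<And>z. \<lbrakk>x < z; z < b\<rbrakk> \<Longrightarrow> \<bar>f z - f x\<bar> \<le> B * (z - x)"
  shows "\<bar>deriv f x\<bar> \<le> B"
proof (rule tendsto_upperbound)
  have "DERIV f x :> deriv f x"
    using assms(1) DERIV_deriv_iff_real_differentiable by blast
  then have "((\<lambda>z. (f z - f x) / (z - x)) \<longlongrightarrow> deriv f x) (at_right x)"
    unfolding has_field_derivative_iff by (rule tendsto_within_subset) auto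
  then show "((\<lambda>z. \<bar>(f z - f x) / (z - x)\<bar>) \<longlongrightarrow> \<bar>deriv f x\<bar>) (at_right x)"
    by (rule tendsto_rabs)
  have "\<forall>\<^sub>F z in at_right x. x < z \<and> z < b"
    using \<open>x < b\<close> eventually_at_right by blast
  then show "\<forall>\<^sub>F z in at_right x. \<bar>(f z - f x) / (z - x)\<bar> \<le> B"
  proof eventually_elim
    case (elim z)
    with le[of z] show ?case by (simp add: pos_divide_le_eq)
  qed
qed auto

section \<open>The kernel of the fractional derivative\<close>

lemma has_integral_kernel:
  fixes \<alpha> :: real
  assumes "\<alpha> < 1" "a \<le> b" "b \<le> t"
  shows "((\<lambda>s. (t - s) powr (-\<alpha>)) has_integral
          ((t - a) powr (1 - \<alpha>) - (t - b) powr (1 - \<alpha>)) / (1 - \<alpha>)) {a..b}"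
proof -
  have "((\<lambda>s. (t - s) powr (-\<alpha>)) has_integral
          (- ((t - b) powr (1 - \<alpha>)) / (1 - \<alpha>) - (- ((t - a) powr (1 - \<alpha>)) / (1 - \<alpha>)))) {a..b}"
  proof (rule fundamental_theorem_of_calculus_interior[OF \<open>a \<le> b\<close>])
    show "continuous_on {a..b} (\<lambda>s. - ((t - s) powr (1 - \<alpha>)) / (1 - \<alpha>))"
      using assms by (intro continuous_on_divide continuous_on_minus continuous_on_powr'
            continuous_on_diff continuous_on_const continuous_on_id) auto
    fix s assume "s \<in> {a<..<b}"
    then have "((\<lambda>s. (t - s) powr (1 - \<alpha>)) has_real_derivative
        (1 - \<alpha>) * (t - s) powr (1 - \<alpha> - real 1) * (-1)) (at s)"
      using assms by (intro DERIV_fun_powr) (auto intro!: derivative_eq_intros)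
    from DERIV_cdivide[OF DERIV_minus[OF this], of "1 - \<alpha>"]
    show "((\<lambda>s. - ((t - s) powr (1 - \<alpha>)) / (1 - \<alpha>)) has_vector_derivative (t - s) powr (-\<alpha>)) (at s)"
      using assms unfolding has_real_derivative_iff_has_vector_derivative[symmetric] by simp
  qed
  then show ?thesis by (simp add: diff_divide_distrib)
qed

text \<open>
  The exponents add up to \<open>-1\<close>, so the integral is scale invariant and does not depend on \<open>t\<close>.
\<close>

lemma has_integral_Beta_kernel:
  fixes \<alpha> t :: real
  assumes "0 < \<alpha>" "\<alpha> < 1" "0 < t"
  shows "((\<lambda>s. (t - s) powr (-\<alpha>) * s powr (\<alpha> - 1)) has_integral Beta \<alpha> (1 - \<alpha>)) {0..t}"
proof -
  have "((\<lambda>x. x powr (\<alpha> - 1) * (1 - x) powr (-\<alpha>)) has_integral Beta \<alpha> (1 - \<alpha>)) (cbox 0 1)"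
    using has_integral_Beta_real[of \<alpha> "1 - \<alpha>"] assms by simp
  from has_integral_affinity'[OF this, of "1 / t" 0] assms
  have "((\<lambda>x. (x / t) powr (\<alpha> - 1) * (1 - x / t) powr (-\<alpha>)) has_integral t * Beta \<alpha> (1 - \<alpha>)) {0..t}"
    by simp
  from has_integral_mult_right[OF this, of "1 / t"] assms
  have "((\<lambda>x. 1 / t * ((x / t) powr (\<alpha> - 1) * (1 - x / t) powr (-\<alpha>))) has_integral Beta \<alpha> (1 - \<alpha>)) {0..t}"
    by simp
  then show ?thesis
  proof (rule has_integral_eq[rotated])
    fix s assume s: "s \<in> {0..t}"
    have "1 - s / t = (t - s) / t" using assms by (simp add: field_simps)
    then have "1 / t * ((s / t) powr (\<alpha> - 1) * (1 - s / t) powr (-\<alpha>))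
        = (t - s) powr (-\<alpha>) * s powr (\<alpha> - 1) * (1 / (t * t powr (\<alpha> - 1) * t powr (-\<alpha>)))"
      using s assms by (simp add: powr_divide field_simps)
    also have "t * t powr (\<alpha> - 1) * t powr (-\<alpha>) = 1"
      using assms by (simp add: powr_diff powr_minus field_simps)
    finally show "1 / t * ((s / t) powr (\<alpha> - 1) * (1 - s / t) powr (-\<alpha>))
        = (t - s) powr (-\<alpha>) * s powr (\<alpha> - 1)" by simp
  qed
qed

section \<open>Elementary estimates for sums of powers\<close>

lemma powr_le_of_half_le:
  fixes x y c :: real
  assumes "0 < y" "y / 2 \<le> x" "0 \<le> c"
  shows "x powr (-c) \<le> 2 powr c * y powr (-c)"
proof -
  have "x powr (-c) \<le> (y / 2) powr (-c)"
    using assms by (intro powr_mono2') auto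
  also have "\<dots> = 2 powr c * y powr (-c)"
    using assms by (simp add: powr_divide powr_minus field_simps)
  finally show ?thesis .
qed

lemma powr_singular_le_of_half_le:
  fixes x y \<alpha> :: real
  assumes "0 < \<alpha>" "\<alpha> < 1" "0 < y" "y / 2 \<le> x"
  shows "x powr (\<alpha> - 1) \<le> 2 * y powr (\<alpha> - 1)"
proof -
  have "x powr (\<alpha> - 1) \<le> 2 powr (1 - \<alpha>) * y powr (\<alpha> - 1)"
    using powr_le_of_half_le[of y x "1 - \<alpha>"] assms by simp
  also have "\<dots> \<le> 2 * y powr (\<alpha> - 1)"
    using assms powr_mono[of "1 - \<alpha>" 1 2] by (intro mult_right_mono) auto
  finally show ?thesis .
qed

lemma powr_minus_diff_le:
  fixes \<alpha> u v :: real
  assumes "0 < \<alpha>" "\<alpha> < 1" "0 < u" "u < v"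
  shows "u powr (-\<alpha>) - v powr (-\<alpha>) \<le> (v - u) * u powr (-(\<alpha> + 1))"
proof -
  have "\<exists>z>u. z < v \<and> v powr (-\<alpha>) - u powr (-\<alpha>) = (v - u) * (-\<alpha> * z powr (-\<alpha> - 1))"
    using assms by (intro MVT2) (auto intro!: derivative_eq_intros)
  then obtain z where z: "u < z" "v powr (-\<alpha>) - u powr (-\<alpha>) = (v - u) * (-\<alpha> * z powr (-\<alpha> - 1))"
    by blast
  have "\<alpha> * z powr (-\<alpha> - 1) \<le> 1 * u powr (-\<alpha> - 1)"
    using z assms by (intro mult_mono powr_mono2') auto
  then have "(v - u) * (\<alpha> * z powr (-\<alpha> - 1)) \<le> (v - u) * u powr (-\<alpha> - 1)"
    using assms by (intro mult_left_mono) auto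
  moreover have "u powr (-\<alpha>) - v powr (-\<alpha>) = (v - u) * (\<alpha> * z powr (-\<alpha> - 1))"
    using z(2) by (simp add: algebra_simps)
  ultimately show ?thesis by simp
qed

lemma sum_powr_le:
  fixes \<alpha> :: real
  assumes "0 < \<alpha>" "\<alpha> < 1"
  shows "(\<Sum>i=1..m. real i powr (\<alpha> - 1)) \<le> real m powr \<alpha> / \<alpha>"
proof (induction m)
  case (Suc m)
  have "real (Suc m) powr (\<alpha> - 1) \<le> (real (Suc m) powr \<alpha> - real m powr \<alpha>) / \<alpha>"
  proof (cases "m = 0")
    case False
    have "\<exists>z>real m. z < real (Suc m) \<and> real (Suc m) powr \<alpha> - real m powr \<alpha>
            = (real (Suc m) - real m) * (\<alpha> * z powr (\<alpha> - 1))"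
      using assms False by (intro MVT2) (auto intro!: derivative_eq_intros)
    then obtain z where z: "real m < z" "z < real (Suc m)"
        "real (Suc m) powr \<alpha> - real m powr \<alpha> = (real (Suc m) - real m) * (\<alpha> * z powr (\<alpha> - 1))"
      by blast
    have "real (Suc m) powr (\<alpha> - 1) \<le> z powr (\<alpha> - 1)"
      using z assms by (intro powr_mono2') auto
    with z(3) assms show ?thesis by (simp add: field_simps)
  qed (use assms in \<open>simp add: field_simps\<close>)
  with Suc.IH show ?case by (simp add: diff_divide_distrib)
qed simp

text \<open>
  With \<open>N = m + 1\<close>, scaling by \<open>H\<close> turns the summands into \<open>i\<^sup>\<alpha>\<^sup>-\<^sup>1 D i\<close>, where \<open>D i\<close> is the kernel increment over
  the \<open>i\<close>-th cell times \<open>H\<^sup>\<alpha>\<close>. Depending on whether \<open>i \<ge> N/2\<close>, one of the two factors can be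
  replaced by its size at the end of the grid where it is smallest, namely \<open>N\<^sup>\<alpha>\<^sup>-\<^sup>1\<close> or \<open>N\<^sup>-\<^sup>\<alpha>\<^sup>-\<^sup>1\<close>, and the
  other one can be summed.
  Bounding each summand by the sum of both estimates avoids splitting the range.
\<close>

lemma uniform_grid_sum_le:
  fixes \<alpha> H t :: real
  assumes \<alpha>: "0 < \<alpha>" "\<alpha> < 1" and "0 < H" and t: "(real m + 1) * H \<le> t"
  shows "(\<Sum>i=1..m. (real i * H) powr (\<alpha> - 1) * H *
            ((t - real i * H) powr (-\<alpha>) - (t - real (i - 1) * H) powr (-\<alpha>)))
         \<le> (2 + 4 / \<alpha>) * (real m + 1) powr (\<alpha> - 1)"
proof -
  define N where "N = real m + 1"
  define \<phi> where "\<phi> = (\<lambda>i. (t - real i * H) powr (-\<alpha>))"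
  define D where "D = (\<lambda>i. H powr \<alpha> * (\<phi> i - \<phi> (i - 1)))"
  have "1 \<le> N" by (simp add: N_def)
  have dist: "(N - real i) * H \<le> t - real i * H" for i
    using t by (simp add: N_def algebra_simps)
  have pos: "0 < t - real i * H" if "i \<le> m" for i
  proof -
    have "0 < (N - real i) * H" using that \<open>0 < H\<close> by (simp add: N_def)
    with dist[of i] show ?thesis by linarith
  qed
  have D_nonneg: "0 \<le> D i" if "i \<le> m" for i
    unfolding D_def \<phi>_def using pos[OF that] \<alpha> \<open>0 < H\<close>
    by (intro mult_nonneg_nonneg) (auto intro!: powr_mono2' mult_right_mono)
  have D_le: "D i \<le> (N - real i) powr (-(\<alpha> + 1))" if i: "i \<in> {1..m}" for i
  proof -
    have "(t - real (i - 1) * H) - (t - real i * H) = H"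
      using i by (simp add: of_nat_diff algebra_simps)
    then have "\<phi> i - \<phi> (i - 1) \<le> H * (t - real i * H) powr (-(\<alpha> + 1))"
      unfolding \<phi>_def
      using powr_minus_diff_le[OF \<alpha>, of "t - real i * H" "t - real (i - 1) * H"] pos[of i] i \<open>0 < H\<close>
      by auto
    also have "\<dots> \<le> H * ((N - real i) * H) powr (-(\<alpha> + 1))"
      using dist[of i] i \<alpha> \<open>0 < H\<close> by (intro mult_left_mono powr_mono2') (auto simp: N_def)
    finally have "D i \<le> H powr \<alpha> * (H * ((N - real i) * H) powr (-(\<alpha> + 1)))"
      unfolding D_def by (rule mult_left_mono) simp
    also have "\<dots> = H powr \<alpha> * H powr 1 * H powr (-(\<alpha> + 1)) * (N - real i) powr (-(\<alpha> + 1))"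
      using i \<open>0 < H\<close> by (simp add: powr_mult N_def)
    also have "H powr \<alpha> * H powr 1 * H powr (-(\<alpha> + 1)) = 1"
      using \<open>0 < H\<close> by (simp only: powr_add[symmetric]) simp
    finally show ?thesis by simp
  qed
  have sum_D: "(\<Sum>i=1..k. D i) = H powr \<alpha> * (\<phi> k - \<phi> 0)" for k
    by (induction k) (auto simp: D_def algebra_simps)
  have "(\<Sum>i=1..m. D i) \<le> H powr \<alpha> * \<phi> m"
    unfolding sum_D by (intro mult_left_mono) (auto simp: \<phi>_def)
  also have "\<dots> \<le> H powr \<alpha> * H powr (-\<alpha>)"
    unfolding \<phi>_def using dist[of m] \<alpha> \<open>0 < H\<close>
    by (intro mult_left_mono powr_mono2') (auto simp: N_def)
  also have "\<dots> = 1"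
    using \<open>0 < H\<close> by (simp add: powr_add[symmetric])
  finally have sum_D_le: "(\<Sum>i=1..m. D i) \<le> 1" .
  have summand: "real i powr (\<alpha> - 1) * D i
      \<le> 2 * N powr (\<alpha> - 1) * D i + 4 * N powr (-(\<alpha> + 1)) * real i powr (\<alpha> - 1)" if i: "i \<in> {1..m}" for i
  proof (cases "N / 2 \<le> real i")
    case True
    then have "real i powr (\<alpha> - 1) \<le> 2 * N powr (\<alpha> - 1)"
      using \<alpha> \<open>1 \<le> N\<close> by (intro powr_singular_le_of_half_le) auto
    then have "real i powr (\<alpha> - 1) * D i \<le> 2 * N powr (\<alpha> - 1) * D i"
      using D_nonneg[of i] i by (intro mult_right_mono) auto
    then show ?thesis by (simp add: add_increasing2)
  next
    case False
    have "D i \<le> (N - real i) powr (-(\<alpha> + 1))"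
      using i by (rule D_le)
    also have "\<dots> \<le> 2 powr (\<alpha> + 1) * N powr (-(\<alpha> + 1))"
      using False \<alpha> \<open>1 \<le> N\<close> by (intro powr_le_of_half_le) auto
    also have "\<dots> \<le> 4 * N powr (-(\<alpha> + 1))"
      using \<alpha> powr_mono[of "\<alpha> + 1" 2 2] by (intro mult_right_mono) auto
    finally have "real i powr (\<alpha> - 1) * D i \<le> real i powr (\<alpha> - 1) * (4 * N powr (-(\<alpha> + 1)))"
      by (rule mult_left_mono) simp
    also have "\<dots> \<le> 2 * N powr (\<alpha> - 1) * D i + real i powr (\<alpha> - 1) * (4 * N powr (-(\<alpha> + 1)))"
      using D_nonneg[of i] i by simp
    finally show ?thesis by (simp add: mult_ac)
  qed
  have "(\<Sum>i=1..m. (real i * H) powr (\<alpha> - 1) * H *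
            ((t - real i * H) powr (-\<alpha>) - (t - real (i - 1) * H) powr (-\<alpha>)))
      = (\<Sum>i=1..m. real i powr (\<alpha> - 1) * D i)"
    using \<open>0 < H\<close> by (intro sum.cong) (auto simp: D_def \<phi>_def powr_mult powr_diff)
  also have "\<dots> \<le> (\<Sum>i=1..m. 2 * N powr (\<alpha> - 1) * D i + 4 * N powr (-(\<alpha> + 1)) * real i powr (\<alpha> - 1))"
    by (rule sum_mono) (rule summand)
  also have "\<dots> = 2 * N powr (\<alpha> - 1) * (\<Sum>i=1..m. D i)
      + 4 * N powr (-(\<alpha> + 1)) * (\<Sum>i=1..m. real i powr (\<alpha> - 1))"
    by (simp add: sum.distrib sum_distrib_left)
  also have "\<dots> \<le> 2 * N powr (\<alpha> - 1) * 1 + 4 * N powr (-(\<alpha> + 1)) * (N powr \<alpha> / \<alpha>)"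
  proof (intro add_mono mult_left_mono sum_D_le)
    have "real m powr \<alpha> / \<alpha> \<le> N powr \<alpha> / \<alpha>"
      using \<alpha> by (intro divide_right_mono powr_mono2) (auto simp: N_def)
    with sum_powr_le[OF \<alpha>] show "(\<Sum>i=1..m. real i powr (\<alpha> - 1)) \<le> N powr \<alpha> / \<alpha>"
      by (rule order_trans)
  qed auto
  also have "4 * N powr (-(\<alpha> + 1)) * (N powr \<alpha> / \<alpha>) = 4 / \<alpha> * N powr (-1)"
  proof -
    have "N powr (-(\<alpha> + 1)) * N powr \<alpha> = N powr (-1)"
      by (simp only: powr_add[symmetric]) simp
    show ?thesis unfolding \<open>_ = N powr (-1)\<close>[symmetric] by simp
  qed
  also have "2 * N powr (\<alpha> - 1) * 1 + 4 / \<alpha> * N powr (-1) \<le> 2 * N powr (\<alpha> - 1) * 1 + 4 / \<alpha> * N powr (\<alpha> - 1)"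
    using \<alpha> \<open>1 \<le> N\<close> by (intro add_left_mono mult_left_mono powr_mono) auto
  also have "\<dots> = (2 + 4 / \<alpha>) * N powr (\<alpha> - 1)"
    by (simp add: algebra_simps)
  finally show ?thesis by (simp add: N_def)
qed

section \<open>Grid cells and the weights of the L1 scheme\<close>

lemma integral_over_cells:
  fixes f :: "real \<Rightarrow> real"
  assumes mono: "\<And>i. i < n \<Longrightarrow> \<tau> i \<le> \<tau> (Suc i)" and int: "f integrable_on {\<tau> 0..\<tau> n}"
  shows "(\<Sum>i=1..n. integral {\<tau> (i - 1)..\<tau> i} f) = integral {\<tau> 0..\<tau> n} f"
  using assms
proof (induction n)
  case (Suc n)
  have le: "\<tau> 0 \<le> \<tau> n"
    using Suc.prems(1) by (induction n) (auto intro: order_trans)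
  have "\<tau> n \<le> \<tau> (Suc n)" using Suc.prems(1) by auto
  have "f integrable_on {\<tau> 0..\<tau> n}"
    using Suc.prems(2) \<open>\<tau> n \<le> \<tau> (Suc n)\<close> by (auto intro: integrable_subinterval_real)
  with Suc have "(\<Sum>i=1..n. integral {\<tau> (i - 1)..\<tau> i} f) = integral {\<tau> 0..\<tau> n} f"
    by auto
  then show ?case
    using Henstock_Kurzweil_Integration.integral_combine[OF le \<open>\<tau> n \<le> \<tau> (Suc n)\<close> Suc.prems(2)] by simp
qed (simp add: integral_refl)

text \<open>
  For a cell of length \<open>H\<close> whose right end has distance \<open>s H\<close> from \<open>t\<close>, the right-hand side is \<open>1 - \<alpha>\<close>
  times the mean of the kernel over the cell.
\<close>

lemma L1_weight_eq:
  assumes "0 < H" "0 \<le> s" "\<alpha> < 1"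
  shows "H powr (-\<alpha>) * L1_weight \<alpha> s = (((s + 1) * H) powr (1 - \<alpha>) - (s * H) powr (1 - \<alpha>)) / H"
proof -
  have "H powr (1 - \<alpha>) = H * H powr (-\<alpha>)"
    using assms by (simp add: powr_diff powr_minus divide_simps)
  then show ?thesis
    using assms by (simp add: L1_weight_def powr_mult left_diff_distrib[symmetric])
qed

section \<open>Functions with a weak singularity at the origin\<close>

text \<open>
  Since \<open>1 \<le> T\<^sup>1\<^sup>-\<^sup>\<alpha> t\<^sup>\<alpha>\<^sup>-\<^sup>1\<close> on \<open>(0, T]\<close>, a factor \<open>1 + t\<^sup>\<alpha>\<^sup>-\<^sup>1\<close> in the growth condition is equivalent to the
  homogeneous factor \<open>t\<^sup>\<alpha>\<^sup>-\<^sup>1\<close> with a larger constant.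
\<close>

locale weakly_singular =
  fixes \<alpha> T L :: real and y :: "real \<Rightarrow> real"
  assumes \<alpha>_pos: "0 < \<alpha>" and \<alpha>_less: "\<alpha> < 1" and L_nonneg: "0 \<le> L"
    and cont: "continuous_on {0..T} y"
    and growth: "\<And>s t. \<lbrakk>0 \<le> s; s < t; t \<le> T\<rbrakk> \<Longrightarrow> \<bar>y t - y s\<bar> \<le> L * t powr (\<alpha> - 1) * (t - s)"
begin

lemma ae_differentiable: "negligible {x\<in>{0<..<T}. \<not> y differentiable (at x)}"
proof -
  define c where "c = (\<lambda>k. inverse (real (Suc k)))"
  have "negligible {x\<in>{c k<..<T}. \<not> y differentiable (at x)}" for k
  proof (rule lipschitz_ae_differentiable, rule lipschitz_on_leI)
    have "0 < c k" by (simp add: c_def)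
    then show "dist (y u) (y v) \<le> (L * c k powr (\<alpha> - 1)) * dist u v"
      if "u \<in> {c k..T}" "v \<in> {c k..T}" "u \<le> v" for u v
    proof (cases "u = v")
      case False
      with that \<open>0 < c k\<close> have "\<bar>y v - y u\<bar> \<le> L * v powr (\<alpha> - 1) * (v - u)"
        by (intro growth) auto
      also have "\<dots> \<le> L * c k powr (\<alpha> - 1) * (v - u)"
        using that \<open>0 < c k\<close> L_nonneg \<alpha>_less
        by (intro mult_right_mono mult_left_mono powr_mono2') auto
      finally show ?thesis using that by (simp add: dist_real_def abs_minus_commute)
    qed simp
    show "0 \<le> L * c k powr (\<alpha> - 1)" using L_nonneg by simp
  qed
  then have "negligible (\<Union>k. {x\<in>{c k<..<T}. \<not> y differentiable (at x)})"
    by (intro negligible_countable_Union) auto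
  then show ?thesis
  proof (rule negligible_subset, safe)
    fix x assume x: "x \<in> {0<..<T}" "\<not> y differentiable (at x)"
    then obtain k where "c k < x"
      using reals_Archimedean[of x] by (auto simp: c_def)
    with x show "x \<in> (\<Union>k. {x\<in>{c k<..<T}. \<not> y differentiable (at x)})"
      by auto
  qed
qed

text \<open>
  The factor at the smaller argument depends on \<open>x\<close> alone and is integrable near \<open>0\<close>, so it can serve as
  the dominating function for difference quotients at \<open>x\<close>.
\<close>

lemma growth_left:
  assumes "0 < x" "x < z" "z \<le> T"
  shows "\<bar>y z - y x\<bar> \<le> L * x powr (\<alpha> - 1) * (z - x)"
proof -
  have "\<bar>y z - y x\<bar> \<le> L * z powr (\<alpha> - 1) * (z - x)"
    using assms by (intro growth) auto
  also have "\<dots> \<le> L * x powr (\<alpha> - 1) * (z - x)"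
    using assms L_nonneg \<alpha>_less by (intro mult_right_mono mult_left_mono powr_mono2') auto
  finally show ?thesis .
qed

lemma deriv_bound:
  assumes "0 < x" "x < T" "y differentiable (at x)"
  shows "\<bar>deriv y x\<bar> \<le> L * x powr (\<alpha> - 1)"
  by (rule abs_deriv_le[OF assms(3,2)]) (use growth_left assms in auto)

lemma deriv_has_integral:
  assumes "0 \<le> a" "a \<le> b" "b \<le> T"
  shows "(deriv y has_integral y b - y a) {a..b}"
proof (cases "a = b")
  case False
  show ?thesis
  proof (rule integral_deriv_dominated)
    show "a < b" using False assms by auto
    show "continuous_on {a..b} y"
      using cont by (rule continuous_on_subset) (use assms in auto)
    show "negligible {x\<in>{a<..<b}. \<not> y differentiable (at x)}"
      by (rule negligible_subset[OF ae_differentiable]) (use assms in auto)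
    have "(\<lambda>x. x powr (\<alpha> - 1)) integrable_on {0..b}"
      using \<alpha>_pos assms by (intro integrable_on_powr_from_0) auto
    then have "(\<lambda>x. x powr (\<alpha> - 1)) integrable_on {a..b}"
      by (rule integrable_subinterval_real) (use assms in auto)
    then show "(\<lambda>x. L * x powr (\<alpha> - 1)) integrable_on {a..b}"
      by (rule integrable_on_mult_right)
    show "\<bar>y z - y x\<bar> \<le> L * x powr (\<alpha> - 1) * (z - x)" if "a < x" "x < z" "z \<le> b" for x z
      using that assms by (intro growth_left) auto
  qed
qed (simp add: has_integral_refl)

section \<open>The error on one grid cell\<close>

text \<open>
  The contribution of the cell \<open>[a, b]\<close> to \<open>\<Gamma> (1 - \<alpha>)\<close> times the error at \<open>t\<close>: the slope is the derivative of
  the linear interpolant on that cell.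
\<close>

definition cell_error :: "real \<Rightarrow> real \<Rightarrow> real \<Rightarrow> real" where
  "cell_error t a b = integral {a..b} (\<lambda>s. (t - s) powr (-\<alpha>) * deriv y s)
     - (y b - y a) / (b - a) * integral {a..b} (\<lambda>s. (t - s) powr (-\<alpha>))"

lemma kernel_integral:
  assumes "a \<le> b" "b \<le> t"
  shows "integral {a..b} (\<lambda>s. (t - s) powr (-\<alpha>))
           = ((t - a) powr (1 - \<alpha>) - (t - b) powr (1 - \<alpha>)) / (1 - \<alpha>)"
  using has_integral_kernel[OF \<alpha>_less assms] by (rule integral_unique)

text \<open>
  Each of the two increments is bounded by the growth condition. The factor \<open>c\<^sup>\<alpha>\<^sup>-\<^sup>1\<close> may be much larger than
  \<open>b\<^sup>\<alpha>\<^sup>-\<^sup>1\<close>; this is harmless in a cell starting at \<open>0\<close>, where it occurs as \<open>c\<^sup>\<alpha>\<^sup>-\<^sup>1 c = c\<^sup>\<alpha>\<close>, and in a cell with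
  \<open>b \<le> 2 a\<close>, where it costs a factor \<open>2\<close>.
\<close>

lemma interpolation_error:
  assumes "0 \<le> a" "a \<le> c" "c \<le> b" "a < b" "b \<le> T" and ab: "a = 0 \<or> b \<le> 2 * a"
  shows "\<bar>(y c - y a) - (y b - y a) / (b - a) * (c - a)\<bar> \<le> 3 * L * b powr (\<alpha> - 1) * (b - a)"
proof -
  have "\<bar>y c - y a\<bar> \<le> 2 * L * b powr (\<alpha> - 1) * (b - a)"
  proof (cases "a = c")
    case False
    with assms have "\<bar>y c - y a\<bar> \<le> L * (c powr (\<alpha> - 1) * (c - a))"
      using growth[of a c] by (simp add: mult.assoc)
    also have "\<dots> \<le> L * (2 * b powr (\<alpha> - 1) * (b - a))"
    proof (rule mult_left_mono)
      show "c powr (\<alpha> - 1) * (c - a) \<le> 2 * b powr (\<alpha> - 1) * (b - a)"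
      proof (cases "a = 0")
        case True
        have "c powr (\<alpha> - 1) * c = c powr \<alpha>" "b powr (\<alpha> - 1) * b = b powr \<alpha>"
          using False True assms by (auto simp: powr_diff)
        moreover have "c powr \<alpha> \<le> b powr \<alpha>"
          using assms \<alpha>_pos True by (intro powr_mono2) auto
        ultimately show ?thesis
          using True powr_ge_zero[of b \<alpha>] unfolding mult.assoc by (simp del: powr_ge_zero)
      next
        case False
        with ab assms have "c powr (\<alpha> - 1) \<le> 2 * b powr (\<alpha> - 1)"
          using \<alpha>_pos \<alpha>_less by (intro powr_singular_le_of_half_le) auto
        then show ?thesis using assms by (intro mult_mono) auto
      qed
    qed (rule L_nonneg)
    finally show ?thesis by (simp add: mult_ac)
  qed (use assms L_nonneg in auto)
  moreover have "\<bar>(y b - y a) / (b - a) * (c - a)\<bar> \<le> L * b powr (\<alpha> - 1) * (b - a)"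
  proof -
    have "\<bar>(y b - y a) / (b - a) * (c - a)\<bar> = \<bar>y b - y a\<bar> * ((c - a) / (b - a))"
      using assms by (simp add: abs_mult)
    also have "\<dots> \<le> \<bar>y b - y a\<bar> * 1"
      using assms by (intro mult_left_mono) auto
    also have "\<dots> \<le> L * b powr (\<alpha> - 1) * (b - a)"
      using growth[of a b] assms by simp
    finally show ?thesis .
  qed
  ultimately have "\<bar>(y c - y a) - (y b - y a) / (b - a) * (c - a)\<bar>
      \<le> 2 * L * b powr (\<alpha> - 1) * (b - a) + L * b powr (\<alpha> - 1) * (b - a)"
    by (rule order_trans[OF abs_triangle_ineq4 add_mono])
  then show ?thesis by (simp add: mult_ac)
qed

text \<open>
  The second mean value theorem takes the place of an integration by parts: since the interpolation error
  \<open>w\<close> vanishes at both ends, it turns the integral of \<open>\<phi> w'\<close> into \<open>(\<phi> a - \<phi> b) w c\<close>. The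
  only fact about \<open>w'\<close> that enters is that it integrates to the increments of \<open>w\<close>.
\<close>

lemma cell_error_le:
  assumes "0 \<le> a" "0 < d" and d: "b - a = d" and "b < t" "b \<le> T" and ad: "a = 0 \<or> d \<le> a"
  shows "\<bar>cell_error t a b\<bar>
           \<le> 3 * L * (b powr (\<alpha> - 1) * d * ((t - b) powr (-\<alpha>) - (t - a) powr (-\<alpha>)))"
proof -
  have "a < b" "a = 0 \<or> b \<le> 2 * a" using \<open>0 < d\<close> d ad by auto
  note asm = assms(1,4,5) this
  define k where "k = (y b - y a) / (b - a)"
  define w where "w = (\<lambda>c. (y c - y a) - k * (c - a))"
  define \<phi> where "\<phi> = (\<lambda>s. (t - s) powr (-\<alpha>))"
  have w_integral: "((\<lambda>s. deriv y s - k) has_integral w v - w u) {u..v}" if "a \<le> u" "u \<le> v" "v \<le> b" for u v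
  proof -
    have "((\<lambda>s. deriv y s - k) has_integral (y v - y u) - (v - u) *\<^sub>R k) {u..v}"
      using that asm has_integral_const_real[of k u v]
      by (intro has_integral_diff deriv_has_integral) auto
    then show ?thesis by (simp add: w_def algebra_simps)
  qed
  have "w a = 0" "w b = 0" using asm by (auto simp: w_def k_def)
  have mono: "\<phi> u \<le> \<phi> v" if "u \<le> v" "v \<le> b" for u v
    using that asm \<alpha>_pos unfolding \<phi>_def by (intro powr_mono2') auto
  obtain c where c: "c \<in> {a..b}" and
    "((\<lambda>s. \<phi> s * (deriv y s - k)) has_integral
       (\<phi> a * integral {a..c} (\<lambda>s. deriv y s - k) + \<phi> b * integral {c..b} (\<lambda>s. deriv y s - k))) {a..b}"
  proof (rule second_mean_value_theorem_full[of "\<lambda>s. deriv y s - k" a b \<phi>])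
    show "(\<lambda>s. deriv y s - k) integrable_on {a..b}"
      using w_integral[of a b] asm by (auto simp: integrable_on_def)
  qed (use asm mono in auto)
  moreover have "integral {a..c} (\<lambda>s. deriv y s - k) = w c" "integral {c..b} (\<lambda>s. deriv y s - k) = - w c"
    using w_integral[of a c] w_integral[of c b] c \<open>w a = 0\<close> \<open>w b = 0\<close>
    by (auto intro!: integral_unique)
  ultimately have "((\<lambda>s. \<phi> s * (deriv y s - k)) has_integral (\<phi> a - \<phi> b) * w c) {a..b}"
    by (simp add: algebra_simps)
  moreover have "(\<phi> has_integral integral {a..b} \<phi>) {a..b}"
    using has_integral_kernel[OF \<alpha>_less, of a b t] asm unfolding \<phi>_def
    by (intro integrable_integral) (auto simp: integrable_on_def)
  ultimately have "((\<lambda>s. \<phi> s * (deriv y s - k) + k * \<phi> s) has_integral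
      (\<phi> a - \<phi> b) * w c + k * integral {a..b} \<phi>) {a..b}"
    by (intro has_integral_add has_integral_mult_right)
  then have "integral {a..b} (\<lambda>s. \<phi> s * deriv y s) = (\<phi> a - \<phi> b) * w c + k * integral {a..b} \<phi>"
    by (intro integral_unique) (simp add: algebra_simps)
  then have "\<bar>cell_error t a b\<bar> = (\<phi> b - \<phi> a) * \<bar>w c\<bar>"
    using mono[of a b] asm by (simp add: cell_error_def \<phi>_def k_def abs_mult)
  also have "\<dots> \<le> (\<phi> b - \<phi> a) * (3 * L * b powr (\<alpha> - 1) * (b - a))"
    using mono[of a b] c asm unfolding w_def k_def
    by (intro mult_left_mono interpolation_error) auto
  finally show ?thesis by (simp add: \<phi>_def d mult_ac)
qed

lemma Beta_kernel_integrable: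
  assumes "0 < t" "0 \<le> a"
  shows "(\<lambda>s. (t - s) powr (-\<alpha>) * s powr (\<alpha> - 1)) integrable_on {a..t}"
proof (rule integrable_subinterval_real)
  show "(\<lambda>s. (t - s) powr (-\<alpha>) * s powr (\<alpha> - 1)) integrable_on {0..t}"
    using has_integral_Beta_kernel[OF \<alpha>_pos \<alpha>_less \<open>0 < t\<close>] by (rule has_integral_integrable)
qed (use assms in auto)

text \<open>
  Near \<open>t\<close> the kernel is unbounded and near \<open>0\<close> the derivative is. Their product is dominated by the
  Beta integrand outside the null set where \<open>y\<close> is not differentiable.
\<close>

lemma caputo_integrand:
  assumes "0 < t" "t \<le> T" "0 \<le> a" "a \<le> t"
  shows "(\<lambda>s. (t - s) powr (-\<alpha>) * deriv y s) integrable_on {a..t}" (is "?f integrable_on _")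
    and "\<bar>integral {a..t} (\<lambda>s. (t - s) powr (-\<alpha>) * deriv y s)\<bar>
           \<le> L * integral {a..t} (\<lambda>s. (t - s) powr (-\<alpha>) * s powr (\<alpha> - 1))"
proof -
  define g where "g = (\<lambda>s. L * ((t - s) powr (-\<alpha>) * s powr (\<alpha> - 1)))"
  \<comment> \<open>Off this null set \<open>deriv y\<close> is the derivative; elsewhere its value is arbitrary.\<close>
  define N where "N = insert 0 (insert t {x\<in>{0<..<T}. \<not> y differentiable (at x)})"
  have N: "negligible N" unfolding N_def using ae_differentiable negligible_insert by blast
  have int_g: "g integrable_on {a..t}"
    unfolding g_def using assms by (intro integrable_on_mult_right Beta_kernel_integrable)
  have le: "norm (?f s) \<le> g s" if "s \<in> {a..t} - N" for s
  proof -
    have "\<bar>deriv y s\<bar> \<le> L * s powr (\<alpha> - 1)"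
      using that assms by (intro deriv_bound) (auto simp: N_def)
    then show ?thesis
      using mult_left_mono[of "\<bar>deriv y s\<bar>" "L * s powr (\<alpha> - 1)" "(t - s) powr (-\<alpha>)"]
      by (simp add: g_def abs_mult mult.left_commute)
  qed
  define S where "S = {a..t} - N"
  have spike: "(f has_integral I) S \<longleftrightarrow> (f has_integral I) {a..t}" for f :: "real \<Rightarrow> real" and I
    unfolding S_def using N
    by (intro has_integral_spike_set_eq) (auto intro: negligible_subset)
  have spike': "f integrable_on S \<longleftrightarrow> f integrable_on {a..t}"
      "integral S f = integral {a..t} f" for f :: "real \<Rightarrow> real"
    by (simp_all only: integrable_on_def integral_def spike)
  have "?f \<in> borel_measurable (lebesgue_on S)"
  proof (intro borel_measurable_times integrable_imp_measurable)
    show "(\<lambda>s. (t - s) powr (-\<alpha>)) integrable_on S"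
      using has_integral_integrable[OF has_integral_kernel[OF \<alpha>_less assms(4) order_refl]]
      by (simp only: spike')
    show "deriv y integrable_on S"
      using has_integral_integrable[OF deriv_has_integral[OF assms(3,4,2)]] by (simp only: spike')
  qed
  then have "?f absolutely_integrable_on S"
  proof (rule measurable_bounded_by_integrable_imp_absolutely_integrable)
    show "S \<in> sets lebesgue"
      unfolding S_def using N by (intro sets.Diff) (auto simp: negligible_iff_null_sets)
    show "g integrable_on S" using int_g by (simp only: spike')
  qed (use le in \<open>auto simp: S_def\<close>)
  then have "?f integrable_on S"
    by (rule absolutely_integrable_on_def[THEN iffD1, THEN conjunct1])
  then show "?f integrable_on {a..t}" by (simp only: spike')
  have "norm (integral S ?f) \<le> integral S g"
  proof (rule integral_norm_bound_integral)
    show "g integrable_on S" using int_g by (simp only: spike')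
  qed (use \<open>?f integrable_on S\<close> le in \<open>auto simp: S_def\<close>)
  then show "\<bar>integral {a..t} ?f\<bar> \<le> L * integral {a..t} (\<lambda>s. (t - s) powr (-\<alpha>) * s powr (\<alpha> - 1))"
    by (simp add: spike' g_def)
qed

definition last_const :: real where
  "last_const = L * (Beta \<alpha> (1 - \<alpha>) + 3 / (1 - \<alpha>))"

text \<open>
  If \<open>a = 0\<close>, the Beta integral is a constant and \<open>t\<^sup>\<alpha>\<^sup>-\<^sup>1 (t - a)\<^sup>1\<^sup>-\<^sup>\<alpha> = 1\<close>. Otherwise \<open>s\<^sup>\<alpha>\<^sup>-\<^sup>1\<close> is at most
  \<open>2 t\<^sup>\<alpha>\<^sup>-\<^sup>1\<close> on the cell and only the kernel has to be integrated.
\<close>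

lemma last_cell_error_le:
  assumes "0 \<le> a" "0 < d" and d: "t - a = d" and "t \<le> T" and ad: "a = 0 \<or> d \<le> a"
  shows "\<bar>cell_error t a t\<bar> \<le> last_const * (t powr (\<alpha> - 1) * d powr (1 - \<alpha>))"
proof -
  have at: "a < t" "a = 0 \<or> t \<le> 2 * a" using \<open>0 < d\<close> d ad by auto
  note asm = assms(1,4) at(1)
  let ?R = "t powr (\<alpha> - 1) * (t - a) powr (1 - \<alpha>)"
  let ?K = "\<lambda>s. (t - s) powr (-\<alpha>) * s powr (\<alpha> - 1)"
  have Beta_pos: "0 < Beta \<alpha> (1 - \<alpha>)"
    using \<alpha>_pos \<alpha>_less by (simp add: Beta_def Gamma_real_pos)
  have int_K: "integral {a..t} ?K \<le> (Beta \<alpha> (1 - \<alpha>) + 2 / (1 - \<alpha>)) * ?R"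
  proof (cases "a = 0")
    case True
    have "integral {a..t} ?K = Beta \<alpha> (1 - \<alpha>)"
      using has_integral_Beta_kernel[OF \<alpha>_pos \<alpha>_less, of t] asm True by (auto intro: integral_unique)
    moreover have "?R = 1"
      using True asm by (simp add: powr_add[symmetric])
    ultimately show ?thesis using \<alpha>_less by simp
  next
    case False
    have "integral {a..t} ?K \<le> integral {a..t} (\<lambda>s. (t - s) powr (-\<alpha>) * (2 * t powr (\<alpha> - 1)))"
    proof (rule integral_le)
      show "?K integrable_on {a..t}"
        using asm by (intro Beta_kernel_integrable) auto
      show "(\<lambda>s. (t - s) powr (-\<alpha>) * (2 * t powr (\<alpha> - 1))) integrable_on {a..t}"
        using has_integral_kernel[OF \<alpha>_less, of a t t] asm
        by (intro integrable_on_mult_left) (auto simp: integrable_on_def)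
      fix s assume "s \<in> {a..t}"
      then show "?K s \<le> (t - s) powr (-\<alpha>) * (2 * t powr (\<alpha> - 1))"
        using False at(2) asm \<alpha>_pos \<alpha>_less by (intro mult_left_mono powr_singular_le_of_half_le) auto
    qed
    also have "\<dots> = 2 / (1 - \<alpha>) * ?R"
      using kernel_integral[of a t t] asm by simp
    also have "\<dots> \<le> (Beta \<alpha> (1 - \<alpha>) + 2 / (1 - \<alpha>)) * ?R"
      using Beta_pos by (intro mult_right_mono) auto
    finally show ?thesis .
  qed
  have "\<bar>integral {a..t} (\<lambda>s. (t - s) powr (-\<alpha>) * deriv y s)\<bar> \<le> L * integral {a..t} ?K"
    using asm by (intro caputo_integrand) auto
  also have "\<dots> \<le> L * ((Beta \<alpha> (1 - \<alpha>) + 2 / (1 - \<alpha>)) * ?R)"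
    using int_K L_nonneg by (rule mult_left_mono)
  finally have 1: "\<bar>integral {a..t} (\<lambda>s. (t - s) powr (-\<alpha>) * deriv y s)\<bar>
      \<le> L * ((Beta \<alpha> (1 - \<alpha>) + 2 / (1 - \<alpha>)) * ?R)" .
  have "\<bar>(y t - y a) / (t - a)\<bar> \<le> L * t powr (\<alpha> - 1)"
    using growth[of a t] asm by (simp add: pos_divide_le_eq)
  then have "\<bar>(y t - y a) / (t - a)\<bar> * ((t - a) powr (1 - \<alpha>) / (1 - \<alpha>))
      \<le> L * t powr (\<alpha> - 1) * ((t - a) powr (1 - \<alpha>) / (1 - \<alpha>))"
    using \<alpha>_less by (intro mult_right_mono) auto
  then have 2: "\<bar>(y t - y a) / (t - a) * integral {a..t} (\<lambda>s. (t - s) powr (-\<alpha>))\<bar>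
      \<le> L * (1 / (1 - \<alpha>) * ?R)"
    using asm \<alpha>_less by (simp add: kernel_integral abs_mult mult_ac)
  have "\<bar>cell_error t a t\<bar> \<le> L * ((Beta \<alpha> (1 - \<alpha>) + 2 / (1 - \<alpha>)) * ?R) + L * (1 / (1 - \<alpha>) * ?R)"
    unfolding cell_error_def using 1 2 by linarith
  also have "\<dots> = last_const * ?R"
    by (simp add: last_const_def field_simps)
  finally show ?thesis unfolding d .
qed

lemma last_const_nonneg: "0 \<le> last_const"
  using \<alpha>_pos \<alpha>_less L_nonneg
  by (auto simp: last_const_def Beta_def Gamma_real_pos intro!: mult_nonneg_nonneg add_nonneg_nonneg less_imp_le)

section \<open>The error of the hybrid operator as a sum over cells\<close>

text \<open>
  Both parts of the grid are uniform, with first node \<open>0\<close> and \<open>T\<^sub>n\<close>; this is their common half of the error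
  representation.
\<close>

lemma sum_cell_error_uniform:
  assumes "0 < d" "0 \<le> c" "c + real k * d \<le> t" "0 < t" "t \<le> T"
  shows "(\<Sum>j=1..k. cell_error t (c + real (j - 1) * d) (c + real j * d)) =
     integral {c..c + real k * d} (\<lambda>s. (t - s) powr (-\<alpha>) * deriv y s)
     - d powr (-\<alpha>) * (\<Sum>j=1..k. L1_weight \<alpha> ((t - (c + real j * d)) / d) *
                           (y (c + real j * d) - y (c + real (j - 1) * d))) / (1 - \<alpha>)"
proof -
  define \<tau> where "\<tau> = (\<lambda>j. c + real j * d)"
  define f where "f = (\<lambda>s. (t - s) powr (-\<alpha>) * deriv y s)"
  have \<tau>_mono: "\<tau> i \<le> \<tau> j" if "i \<le> j" for i j
    using that \<open>0 < d\<close> by (simp add: \<tau>_def)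
  have \<tau>_le: "\<tau> j \<le> t" if "j \<le> k" for j
    using \<tau>_mono[OF that] assms unfolding \<tau>_def by linarith
  have "f integrable_on {c..t}"
    unfolding f_def using assms \<tau>_le[of 0] by (intro caputo_integrand) (auto simp: \<tau>_def)
  then have "f integrable_on {\<tau> 0..\<tau> k}"
    by (rule integrable_subinterval_real) (use \<tau>_le[of k] in \<open>auto simp: \<tau>_def\<close>)
  then have int: "(\<Sum>j=1..k. integral {\<tau> (j - 1)..\<tau> j} f) = integral {\<tau> 0..\<tau> k} f"
    by (intro integral_over_cells \<tau>_mono) auto
  have cell: "cell_error t (\<tau> (j - 1)) (\<tau> j) = integral {\<tau> (j - 1)..\<tau> j} f
      - d powr (-\<alpha>) * (L1_weight \<alpha> ((t - \<tau> j) / d) * (y (\<tau> j) - y (\<tau> (j - 1)))) / (1 - \<alpha>)"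
    if j: "j \<in> {1..k}" for j
  proof -
    have step: "\<tau> j - \<tau> (j - 1) = d"
      using j by (simp add: \<tau>_def of_nat_diff algebra_simps)
    have "0 \<le> (t - \<tau> j) / d" using \<tau>_le[of j] j \<open>0 < d\<close> by auto
    moreover have "(t - \<tau> j) / d * d = t - \<tau> j" "((t - \<tau> j) / d + 1) * d = t - \<tau> (j - 1)"
      using \<open>0 < d\<close> step by (auto simp: distrib_right)
    ultimately have "d powr (-\<alpha>) * L1_weight \<alpha> ((t - \<tau> j) / d)
        = ((t - \<tau> (j - 1)) powr (1 - \<alpha>) - (t - \<tau> j) powr (1 - \<alpha>)) / d"
      using L1_weight_eq[OF \<open>0 < d\<close> _ \<alpha>_less] by simp
    moreover have "integral {\<tau> (j - 1)..\<tau> j} (\<lambda>s. (t - s) powr (-\<alpha>))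
        = ((t - \<tau> (j - 1)) powr (1 - \<alpha>) - (t - \<tau> j) powr (1 - \<alpha>)) / (1 - \<alpha>)"
      using j by (intro kernel_integral \<tau>_mono \<tau>_le) auto
    ultimately show ?thesis
      unfolding cell_error_def f_def step mult.assoc[symmetric] by simp
  qed
  have "(\<Sum>j=1..k. cell_error t (\<tau> (j - 1)) (\<tau> j)) = (\<Sum>j=1..k. integral {\<tau> (j - 1)..\<tau> j} f
      - d powr (-\<alpha>) * (L1_weight \<alpha> ((t - \<tau> j) / d) * (y (\<tau> j) - y (\<tau> (j - 1)))) / (1 - \<alpha>))"
    by (rule sum.cong[OF refl cell])
  also have "\<dots> = integral {\<tau> 0..\<tau> k} f
      - d powr (-\<alpha>) * (\<Sum>j=1..k. L1_weight \<alpha> ((t - \<tau> j) / d) * (y (\<tau> j) - y (\<tau> (j - 1)))) / (1 - \<alpha>)"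
    unfolding int[symmetric] by (simp add: sum_subtractf sum_distrib_left sum_divide_distrib)
  finally show ?thesis by (simp add: \<tau>_def f_def)
qed

lemma caputo_minus_hybrid:
  fixes M n r N\<^sub>t :: nat
  defines "H \<equiv> coarse_step T N\<^sub>t" and "h \<equiv> fine_step T N\<^sub>t M" and "t \<equiv> fine_node T N\<^sub>t M n r"
  assumes "0 < H" "1 \<le> M" "1 \<le> r" "t \<le> T"
  shows "caputo \<alpha> y t - hybrid_L1 \<alpha> T N\<^sub>t M y n r
    = ((\<Sum>i=1..n. cell_error t (real (i - 1) * H) (real i * H))
       + (\<Sum>j=1..r. cell_error t (real n * H + real (j - 1) * h) (real n * H + real j * h)))
      / Gamma (1 - \<alpha>)"
proof -
  have h: "h = H / real M" "0 < h" using assms by (auto simp: fine_step_def)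
  have t: "t = real n * H + real r * h"
    by (simp add: t_def fine_node_def coarse_node_def H_def h_def)
  have "0 < real r * h" using h(2) \<open>1 \<le> r\<close> by simp
  then have tn: "0 < t" "real n * H \<le> t" "0 \<le> real n * H" using t \<open>0 < H\<close> by (auto intro: add_nonneg_pos)
  let ?f = "\<lambda>s. (t - s) powr (-\<alpha>) * deriv y s"
  define A where "A = H powr (-\<alpha>) * (\<Sum>i=1..n. L1_weight \<alpha> (real (n - i) + real r / real M) *
           (y (real i * H) - y (real (i - 1) * H)))"
  define B where "B = h powr (-\<alpha>) * (\<Sum>j=1..r. L1_weight \<alpha> (real (r - j)) *
           (y (real n * H + real j * h) - y (real n * H + real (j - 1) * h)))"
  have coarse: "(\<Sum>i=1..n. cell_error t (real (i - 1) * H) (real i * H))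
      = integral {0..real n * H} ?f - A / (1 - \<alpha>)"
  proof -
    have "(t - real i * H) / H = real (n - i) + real r / real M" if "i \<in> {1..n}" for i
      using that \<open>0 < H\<close> by (simp add: t h of_nat_diff add_divide_distrib diff_divide_distrib)
    then have "A = H powr (-\<alpha>) * (\<Sum>i=1..n. L1_weight \<alpha> ((t - (0 + real i * H)) / H) *
           (y (0 + real i * H) - y (0 + real (i - 1) * H)))"
      by (simp add: A_def)
    then show ?thesis
      using sum_cell_error_uniform[of H 0 n t] tn \<open>0 < H\<close> \<open>t \<le> T\<close> by simp
  qed
  have fine: "(\<Sum>j=1..r. cell_error t (real n * H + real (j - 1) * h) (real n * H + real j * h))
      = integral {real n * H..t} ?f - B / (1 - \<alpha>)"
  proof -
    have "(t - (real n * H + real j * h)) / h = real (r - j)" if "j \<in> {1..r}" for j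
      using that h(2) by (simp add: t of_nat_diff diff_divide_distrib)
    then have "B = h powr (-\<alpha>) * (\<Sum>j=1..r. L1_weight \<alpha> ((t - (real n * H + real j * h)) / h) *
           (y (real n * H + real j * h) - y (real n * H + real (j - 1) * h)))"
      by (simp add: B_def)
    then show ?thesis
      using sum_cell_error_uniform[of h "real n * H" r t] tn h(2) \<open>t \<le> T\<close> t by simp
  qed
  have "integral {0..t} ?f = integral {0..real n * H} ?f + integral {real n * H..t} ?f"
    using tn \<open>t \<le> T\<close>
    by (intro Henstock_Kurzweil_Integration.integral_combine[symmetric] caputo_integrand) auto
  moreover have "Gamma (2 - \<alpha>) = (1 - \<alpha>) * Gamma (1 - \<alpha>)"
    using Gamma_plus1[of "1 - \<alpha>"] \<alpha>_less nonpos_Ints_nonpos[of "1 - \<alpha>"] by fastforce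
  then have "hybrid_L1 \<alpha> T N\<^sub>t M y n r = (A / (1 - \<alpha>) + B / (1 - \<alpha>)) / Gamma (1 - \<alpha>)"
    by (simp add: hybrid_L1_def A_def B_def coarse_node_def fine_node_def H_def h_def add_divide_distrib)
  ultimately show ?thesis
    unfolding coarse fine caputo_def by (simp add: add_divide_distrib diff_divide_distrib)
qed

section \<open>Summing the cell errors\<close>

definition grid_const :: real where
  "grid_const = 3 * L * (2 + 4 / \<alpha>)"

text \<open>
  This serves the coarse cells before \<open>T\<^bsub>n-1\<^esub>\<close> as well as all but the last fine cell of the first interval:
  in both cases a further full step separates the last of the \<open>m\<close> cells from \<open>t\<close>.
\<close>

lemma uniform_grid_error_le:
  assumes "0 < H" "(real m + 1) * H \<le> t" "t \<le> T"
  shows "(\<Sum>i=1..m. \<bar>cell_error t (real (i - 1) * H) (real i * H)\<bar>)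
           \<le> grid_const * (real m + 1) powr (\<alpha> - 1)"
proof -
  have "\<bar>cell_error t (real (i - 1) * H) (real i * H)\<bar>
      \<le> 3 * L * ((real i * H) powr (\<alpha> - 1) * H *
            ((t - real i * H) powr (-\<alpha>) - (t - real (i - 1) * H) powr (-\<alpha>)))"
    if i: "i \<in> {1..m}" for i
  proof -
    have step: "real i * H - real (i - 1) * H = H"
      using i by (simp add: of_nat_diff algebra_simps)
    have "(real i + 1) * H \<le> (real m + 1) * H"
      using i \<open>0 < H\<close> by simp
    then have "real i * H < t"
      using assms unfolding distrib_right by linarith
    moreover have "real (i - 1) * H = 0 \<or> H \<le> real (i - 1) * H"
      using \<open>0 < H\<close> by (cases "i - 1 = 0") auto
    ultimately show ?thesis
      using step assms by (intro cell_error_le) auto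
  qed
  then have "(\<Sum>i=1..m. \<bar>cell_error t (real (i - 1) * H) (real i * H)\<bar>)
      \<le> 3 * L * (\<Sum>i=1..m. (real i * H) powr (\<alpha> - 1) * H *
            ((t - real i * H) powr (-\<alpha>) - (t - real (i - 1) * H) powr (-\<alpha>)))"
    unfolding sum_distrib_left by (rule sum_mono)
  also have "\<dots> \<le> 3 * L * ((2 + 4 / \<alpha>) * (real m + 1) powr (\<alpha> - 1))"
    using L_nonneg by (intro mult_left_mono uniform_grid_sum_le \<alpha>_pos \<alpha>_less assms) auto
  finally show ?thesis by (simp add: grid_const_def mult.assoc)
qed

lemma first_interval_error_le:
  assumes "0 < h" "1 \<le> r" "real r * h \<le> T"
  shows "\<bar>\<Sum>j=1..r. cell_error (real r * h) (real (j - 1) * h) (real j * h)\<bar>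
           \<le> (grid_const + last_const) * real r powr (\<alpha> - 1)"
proof -
  define t where "t = real r * h"
  obtain m where r: "r = Suc m" using \<open>1 \<le> r\<close> by (cases r) auto
  have "0 < t" using assms by (simp add: t_def)
  have "\<bar>cell_error t (real m * h) t\<bar> \<le> last_const * (t powr (\<alpha> - 1) * (t - real m * h) powr (1 - \<alpha>))"
  proof (rule last_cell_error_le)
    show "real m * h = 0 \<or> t - real m * h \<le> real m * h"
      using \<open>0 < h\<close> by (cases m) (auto simp: t_def r algebra_simps)
  qed (use assms in \<open>auto simp: t_def r\<close>)
  also have "t powr (\<alpha> - 1) * (t - real m * h) powr (1 - \<alpha>) = real r powr (\<alpha> - 1)"
  proof -
    have "t - real m * h = h" by (simp add: t_def r distrib_right)
    moreover have "h powr (\<alpha> - 1) * h powr (1 - \<alpha>) = 1"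
      using \<open>0 < h\<close> by (simp add: powr_add[symmetric])
    ultimately show ?thesis using assms by (simp add: t_def powr_mult mult.assoc)
  qed
  finally have last: "\<bar>cell_error t (real m * h) t\<bar> \<le> last_const * real r powr (\<alpha> - 1)" .
  have "\<bar>\<Sum>j=1..r. cell_error t (real (j - 1) * h) (real j * h)\<bar>
      \<le> (\<Sum>j=1..r. \<bar>cell_error t (real (j - 1) * h) (real j * h)\<bar>)"
    by (rule sum_abs)
  also have "\<dots> = (\<Sum>j=1..m. \<bar>cell_error t (real (j - 1) * h) (real j * h)\<bar>) + \<bar>cell_error t (real m * h) t\<bar>"
    by (simp add: r t_def)
  also have "\<dots> \<le> grid_const * real r powr (\<alpha> - 1) + last_const * real r powr (\<alpha> - 1)"
    using uniform_grid_error_le[of h m t] assms last by (simp add: r t_def add.commute)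
  finally show ?thesis by (simp add: t_def distrib_right)
qed

text \<open>
  All these cells lie to the right of \<open>c\<close>, so one factor \<open>c\<^sup>\<alpha>\<^sup>-\<^sup>1\<close> works for all of them and the kernel
  increments telescope to at most \<open>h\<^sup>-\<^sup>\<alpha>\<close>.
\<close>

lemma fine_cells_error_le:
  assumes "0 < h" "h \<le> c" "1 \<le> r" "c + real r * h \<le> T"
  shows "\<bar>\<Sum>j=1..r. cell_error (c + real r * h) (c + real (j - 1) * h) (c + real j * h)\<bar>
           \<le> (3 * L + last_const) * (c powr (\<alpha> - 1) * h powr (1 - \<alpha>))"
proof -
  define t where "t = c + real r * h"
  define \<phi> where "\<phi> = (\<lambda>j. (t - (c + real j * h)) powr (-\<alpha>))"
  obtain m where r: "r = Suc m" using \<open>1 \<le> r\<close> by (cases r) auto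
  have "0 < c" using assms by simp
  have powr_c: "x powr (\<alpha> - 1) \<le> c powr (\<alpha> - 1)" if "c \<le> x" for x
    using that \<open>0 < c\<close> \<alpha>_less by (intro powr_mono2') auto
  have cell: "\<bar>cell_error t (c + real (j - 1) * h) (c + real j * h)\<bar>
      \<le> 3 * L * (c powr (\<alpha> - 1) * h) * (\<phi> j - \<phi> (j - 1))" if j: "j \<in> {1..m}" for j
  proof -
    have step: "(c + real j * h) - (c + real (j - 1) * h) = h"
      using j by (simp add: of_nat_diff algebra_simps)
    have "real j * h < real r * h" using j \<open>0 < h\<close> by (simp add: r)
    then have lt: "c + real j * h < t" by (simp add: t_def)
    have "0 \<le> real (j - 1) * h" using \<open>0 < h\<close> by simp
    then have ge: "h \<le> c + real (j - 1) * h" using \<open>h \<le> c\<close> by linarith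
    have "\<bar>cell_error t (c + real (j - 1) * h) (c + real j * h)\<bar>
        \<le> 3 * L * ((c + real j * h) powr (\<alpha> - 1) * h * (\<phi> j - \<phi> (j - 1)))"
      unfolding \<phi>_def
    proof (rule cell_error_le)
      show "0 \<le> c + real (j - 1) * h" using ge \<open>0 < h\<close> by linarith
      show "c + real j * h < t" "c + real j * h \<le> T"
        using lt assms(4) unfolding t_def by linarith+
    qed (use \<open>0 < h\<close> step ge in auto)
    also have "\<dots> \<le> 3 * L * (c powr (\<alpha> - 1) * h * (\<phi> j - \<phi> (j - 1)))"
    proof (intro mult_left_mono mult_right_mono powr_c)
      show "0 \<le> \<phi> j - \<phi> (j - 1)"
        using lt step \<open>0 < h\<close> \<alpha>_pos unfolding \<phi>_def by (simp add: powr_mono2')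
    qed (use \<open>0 < h\<close> L_nonneg in auto)
    finally show ?thesis by (simp add: mult.assoc)
  qed
  have "(\<Sum>j=1..m. \<phi> j - \<phi> (j - 1)) = \<phi> m - \<phi> 0"
    by (induction m) auto
  also have "\<dots> \<le> h powr (-\<alpha>)"
    by (simp add: \<phi>_def t_def r algebra_simps)
  finally have tel: "(\<Sum>j=1..m. \<phi> j - \<phi> (j - 1)) \<le> h powr (-\<alpha>)" .
  have "(\<Sum>j=1..m. \<bar>cell_error t (c + real (j - 1) * h) (c + real j * h)\<bar>)
      \<le> 3 * L * (c powr (\<alpha> - 1) * h) * (\<Sum>j=1..m. \<phi> j - \<phi> (j - 1))"
    unfolding sum_distrib_left by (rule sum_mono) (rule cell)
  also have "\<dots> \<le> 3 * L * (c powr (\<alpha> - 1) * h) * h powr (-\<alpha>)"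
    using tel L_nonneg \<open>0 < h\<close> by (intro mult_left_mono) auto
  also have "\<dots> = 3 * L * (c powr (\<alpha> - 1) * h powr (1 - \<alpha>))"
    using \<open>0 < h\<close> by (simp add: powr_diff powr_minus divide_simps)
  finally have inner: "(\<Sum>j=1..m. \<bar>cell_error t (c + real (j - 1) * h) (c + real j * h)\<bar>)
      \<le> 3 * L * (c powr (\<alpha> - 1) * h powr (1 - \<alpha>))" .
  have "t - (c + real m * h) = h" by (simp add: t_def r algebra_simps)
  moreover have "h \<le> c + real m * h" using \<open>0 < h\<close> \<open>h \<le> c\<close> by (simp add: add_increasing2)
  ultimately have "\<bar>cell_error t (c + real m * h) t\<bar> \<le> last_const * (t powr (\<alpha> - 1) * h powr (1 - \<alpha>))"
    using assms(1,2,4) \<open>0 < c\<close> unfolding t_def[symmetric] by (intro last_cell_error_le) auto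
  also have "\<dots> \<le> last_const * (c powr (\<alpha> - 1) * h powr (1 - \<alpha>))"
    using \<open>0 < h\<close> by (intro mult_left_mono mult_right_mono powr_c last_const_nonneg) (auto simp: t_def)
  finally have last: "\<bar>cell_error t (c + real m * h) t\<bar> \<le> last_const * (c powr (\<alpha> - 1) * h powr (1 - \<alpha>))" .
  have "\<bar>\<Sum>j=1..r. cell_error t (c + real (j - 1) * h) (c + real j * h)\<bar>
      \<le> (\<Sum>j=1..r. \<bar>cell_error t (c + real (j - 1) * h) (c + real j * h)\<bar>)"
    by (rule sum_abs)
  also have "\<dots> = (\<Sum>j=1..m. \<bar>cell_error t (c + real (j - 1) * h) (c + real j * h)\<bar>)
      + \<bar>cell_error t (c + real m * h) t\<bar>"
    by (simp add: r t_def)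
  also have "\<dots> \<le> 3 * L * (c powr (\<alpha> - 1) * h powr (1 - \<alpha>)) + last_const * (c powr (\<alpha> - 1) * h powr (1 - \<alpha>))"
    using inner last by (rule add_mono)
  finally show ?thesis by (simp add: t_def distrib_right)
qed

text \<open>
  Only the coarse cell that ends at \<open>T\<^sub>n\<close> needs the factor \<open>M\<^sup>\<alpha>\<close>: the kernel there is at most \<open>h\<^sup>-\<^sup>\<alpha> = H\<^sup>-\<^sup>\<alpha> M\<^sup>\<alpha>\<close>.
  The older history has no power of \<open>M\<close>, and the fine cells have \<open>M\<^sup>\<alpha>\<^sup>-\<^sup>1\<close>.
\<close>

lemma later_interval_error_le:
  fixes M n r :: nat
  assumes "0 < H" "1 \<le> M" "1 \<le> n" "1 \<le> r" and h: "h = H / real M"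
    and t: "t = real n * H + real r * h" "t \<le> T"
  shows "\<bar>(\<Sum>i=1..n. cell_error t (real (i - 1) * H) (real i * H))
       + (\<Sum>j=1..r. cell_error t (real n * H + real (j - 1) * h) (real n * H + real j * h))\<bar>
     \<le> (grid_const + 6 * L + last_const) * (real n powr (\<alpha> - 1) * real M powr \<alpha>)"
proof -
  let ?R = "real n powr (\<alpha> - 1) * real M powr \<alpha>"
  have "0 < h" "h \<le> H" using assms by (auto simp: pos_divide_le_eq)
  obtain m where n: "n = Suc m" using \<open>1 \<le> n\<close> by (cases n) auto
  have "h \<le> real r * h" using \<open>1 \<le> r\<close> \<open>0 < h\<close> by simp
  have M_powr: "1 \<le> real M powr \<alpha>"
    using \<open>1 \<le> M\<close> \<alpha>_pos by (intro ge_one_powr_ge_zero) auto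
  have "(\<Sum>i=1..m. \<bar>cell_error t (real (i - 1) * H) (real i * H)\<bar>) \<le> grid_const * real n powr (\<alpha> - 1)"
    using uniform_grid_error_le[of H m t] assms \<open>0 < h\<close> by (simp add: n add.commute)
  also have "\<dots> \<le> grid_const * ?R"
    using mult_left_mono[OF M_powr, of "real n powr (\<alpha> - 1)"] L_nonneg \<alpha>_pos
    by (intro mult_left_mono) (auto simp: grid_const_def)
  finally have history: "(\<Sum>i=1..m. \<bar>cell_error t (real (i - 1) * H) (real i * H)\<bar>) \<le> grid_const * ?R" .
  have "\<bar>cell_error t (real m * H) (real n * H)\<bar> \<le> 3 * L * ((real n * H) powr (\<alpha> - 1) * H *
      ((t - real n * H) powr (-\<alpha>) - (t - real m * H) powr (-\<alpha>)))"
  proof -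
    have "real m * H = 0 \<or> H \<le> real m * H"
      using \<open>0 < H\<close> by (cases "m = 0") auto
    moreover have "real n * H < t" using t \<open>h \<le> real r * h\<close> \<open>0 < h\<close> by simp
    moreover have "real n * H - real m * H = H" by (simp add: n distrib_right)
    ultimately show ?thesis
      using \<open>0 < H\<close> t(2) by (intro cell_error_le) auto
  qed
  also have "\<dots> \<le> 3 * L * ((real n * H) powr (\<alpha> - 1) * H * h powr (-\<alpha>))"
  proof (intro mult_left_mono)
    have "(t - real n * H) powr (-\<alpha>) \<le> h powr (-\<alpha>)"
      using \<open>h \<le> real r * h\<close> \<open>0 < h\<close> \<alpha>_pos t by (intro powr_mono2') auto
    then show "(t - real n * H) powr (-\<alpha>) - (t - real m * H) powr (-\<alpha>) \<le> h powr (-\<alpha>)"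
      using powr_ge_zero[of "t - real m * H" "-\<alpha>"] by linarith
  qed (use \<open>0 < H\<close> L_nonneg in auto)
  also have "(real n * H) powr (\<alpha> - 1) * H * h powr (-\<alpha>) = ?R"
    using \<open>0 < H\<close> \<open>1 \<le> M\<close>
    by (simp add: h powr_mult powr_divide powr_diff powr_minus divide_simps)
  finally have adjacent: "\<bar>cell_error t (real m * H) (real n * H)\<bar> \<le> 3 * L * ?R" .
  have "H \<le> real n * H" using \<open>0 < H\<close> \<open>1 \<le> n\<close> by simp
  then have "\<bar>\<Sum>j=1..r. cell_error t (real n * H + real (j - 1) * h) (real n * H + real j * h)\<bar>
      \<le> (3 * L + last_const) * ((real n * H) powr (\<alpha> - 1) * h powr (1 - \<alpha>))"
    unfolding t(1) using \<open>0 < h\<close> \<open>h \<le> H\<close> \<open>1 \<le> r\<close> t(2)[unfolded t(1)]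
    by (intro fine_cells_error_le) linarith+
  also have "(real n * H) powr (\<alpha> - 1) * h powr (1 - \<alpha>) = real n powr (\<alpha> - 1) * real M powr (\<alpha> - 1)"
    using \<open>0 < H\<close> \<open>1 \<le> M\<close>
    by (simp add: h powr_mult powr_divide powr_diff powr_minus divide_simps)
  also have "(3 * L + last_const) * \<dots> \<le> (3 * L + last_const) * ?R"
    using \<open>1 \<le> M\<close> L_nonneg last_const_nonneg by (intro mult_left_mono powr_mono) auto
  finally have fine: "\<bar>\<Sum>j=1..r. cell_error t (real n * H + real (j - 1) * h) (real n * H + real j * h)\<bar>
      \<le> (3 * L + last_const) * ?R" .
  have "\<bar>\<Sum>i=1..n. cell_error t (real (i - 1) * H) (real i * H)\<bar>
      \<le> (\<Sum>i=1..n. \<bar>cell_error t (real (i - 1) * H) (real i * H)\<bar>)"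
    by (rule sum_abs)
  also have "\<dots> = (\<Sum>i=1..m. \<bar>cell_error t (real (i - 1) * H) (real i * H)\<bar>)
      + \<bar>cell_error t (real m * H) (real n * H)\<bar>"
    by (simp add: n)
  finally have "\<bar>\<Sum>i=1..n. cell_error t (real (i - 1) * H) (real i * H)\<bar> \<le> grid_const * ?R + 3 * L * ?R"
    using history adjacent by linarith
  with fine have "\<bar>(\<Sum>i=1..n. cell_error t (real (i - 1) * H) (real i * H))
       + (\<Sum>j=1..r. cell_error t (real n * H + real (j - 1) * h) (real n * H + real j * h))\<bar>
     \<le> (grid_const * ?R + 3 * L * ?R) + (3 * L + last_const) * ?R"
    by (intro order_trans[OF abs_triangle_ineq] add_mono)
  also have "\<dots> = (grid_const + 6 * L + last_const) * ?R"
    by (simp add: algebra_simps)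
  finally show ?thesis .
qed

end

section \<open>The error bound\<close>

theorem proposition2:
  fixes \<alpha> T :: real and y :: "real \<Rightarrow> real"
  assumes "0 < \<alpha>" and "\<alpha> < 1" and "0 < T"
    and "continuous_on {0..T} y"
    and "\<exists>C\<^sub>y>0. \<forall>s t. 0 \<le> s \<and> s < t \<and> t \<le> T \<longrightarrow>
           \<bar>y t - y s\<bar> \<le> C\<^sub>y * (1 + t powr (\<alpha> - 1)) * (t - s)"
  shows "\<exists>C>0. \<forall>N\<^sub>t M n r :: nat.
           1 \<le> N\<^sub>t \<and> 1 \<le> M \<and> n \<le> N\<^sub>t - 1 \<and> 1 \<le> r \<and> r \<le> M \<longrightarrow>
             \<bar>caputo \<alpha> y (fine_node T N\<^sub>t M n r) - hybrid_L1 \<alpha> T N\<^sub>t M y n r\<bar>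
             \<le> C * (if n = 0 \<and> r = 1 then 1
                    else if n = 0 then
                      fine_step T N\<^sub>t M powr (1 - \<alpha>) * fine_node T N\<^sub>t M 0 r powr (\<alpha> - 1)
                    else if n = 1 then real M powr \<alpha> / Gamma (1 - \<alpha>)
                    else fine_step T N\<^sub>t M powr (1 - \<alpha>) * coarse_node T N\<^sub>t n powr (\<alpha> - 1)
                           * real M powr (\<alpha> + 1))"
proof -
  obtain C\<^sub>y where "0 < C\<^sub>y" and C\<^sub>y: "\<And>s t. \<lbrakk>0 \<le> s; s < t; t \<le> T\<rbrakk> \<Longrightarrow>
      \<bar>y t - y s\<bar> \<le> C\<^sub>y * (1 + t powr (\<alpha> - 1)) * (t - s)"
    using assms(5) by blast
  define L where "L = C\<^sub>y * (1 + T powr (1 - \<alpha>))"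
  interpret weakly_singular \<alpha> T L y
  proof
    show "0 \<le> L" using \<open>0 < C\<^sub>y\<close> by (simp add: L_def)
    fix s t assume st: "0 \<le> s" "s < t" "t \<le> T"
    have "1 = t powr (1 - \<alpha>) * t powr (\<alpha> - 1)"
      using st by (simp add: powr_add[symmetric])
    also have "\<dots> \<le> T powr (1 - \<alpha>) * t powr (\<alpha> - 1)"
      using st assms by (intro mult_right_mono powr_mono2) auto
    finally have "1 + t powr (\<alpha> - 1) \<le> (1 + T powr (1 - \<alpha>)) * t powr (\<alpha> - 1)"
      by (simp add: distrib_right)
    then have "C\<^sub>y * (1 + t powr (\<alpha> - 1)) * (t - s) \<le> C\<^sub>y * ((1 + T powr (1 - \<alpha>)) * t powr (\<alpha> - 1)) * (t - s)"
      using st \<open>0 < C\<^sub>y\<close> by (intro mult_right_mono mult_left_mono) auto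
    with C\<^sub>y[OF st] show "\<bar>y t - y s\<bar> \<le> L * t powr (\<alpha> - 1) * (t - s)"
      by (simp add: L_def mult.assoc)
  qed (use assms in auto)
  define K where "K = grid_const + 6 * L + last_const"
  define G where "G = Gamma (1 - \<alpha>)"
  \<comment> \<open>In the case \<open>n = 1\<close> the factor \<open>1 / G\<close> belongs to the bound claimed, in all others to the constant.
     The summand \<open>1\<close> keeps \<open>C\<close> positive.\<close>
  define C where "C = K + K / G + 1"
  have "0 < G" using assms by (simp add: G_def Gamma_real_pos)
  have K: "0 \<le> K" "grid_const + last_const \<le> K"
    using L_nonneg last_const_nonneg assms by (auto simp: K_def grid_const_def)
  have C: "K / G \<le> C" "K \<le> C" "0 < C"
    using K \<open>0 < G\<close> by (auto simp: C_def add_nonneg_pos)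
  show ?thesis
  proof (intro exI[of _ C] conjI allI impI)
    fix N\<^sub>t M n r :: nat
    assume idx: "1 \<le> N\<^sub>t \<and> 1 \<le> M \<and> n \<le> N\<^sub>t - 1 \<and> 1 \<le> r \<and> r \<le> M"
    define H where "H = coarse_step T N\<^sub>t"
    define h where "h = fine_step T N\<^sub>t M"
    define t where "t = fine_node T N\<^sub>t M n r"
    define E where "E = \<bar>caputo \<alpha> y t - hybrid_L1 \<alpha> T N\<^sub>t M y n r\<bar>"
    have "0 < H" using idx \<open>0 < T\<close> by (simp add: H_def coarse_step_def)
    have h: "h = H / real M" "0 < h" using idx \<open>0 < H\<close> by (auto simp: h_def H_def fine_step_def)
    have t: "t = real n * H + real r * h"
      by (simp add: t_def fine_node_def coarse_node_def H_def h_def)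
    have "real r * h \<le> real M * h" using idx h(2) by simp
    then have "t \<le> (real n + 1) * H"
      using idx by (simp add: t h(1) distrib_right)
    also have "\<dots> \<le> real N\<^sub>t * H"
      using idx \<open>0 < H\<close> by (intro mult_right_mono) auto
    also have "\<dots> = T" using idx by (simp add: H_def coarse_step_def)
    finally have "t \<le> T" .
    have E: "E = \<bar>(\<Sum>i=1..n. cell_error t (real (i - 1) * H) (real i * H))
       + (\<Sum>j=1..r. cell_error t (real n * H + real (j - 1) * h) (real n * H + real j * h))\<bar> / G"
      using caputo_minus_hybrid[of N\<^sub>t M r n] idx \<open>0 < H\<close> \<open>t \<le> T\<close> \<open>0 < G\<close>
      by (simp add: E_def t_def H_def h_def G_def)
    have first: "E \<le> C * real r powr (\<alpha> - 1)" if "n = 0"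
    proof -
      have "E \<le> (grid_const + last_const) * real r powr (\<alpha> - 1) / G"
        using first_interval_error_le[of h r] that t \<open>t \<le> T\<close> idx h(2) \<open>0 < G\<close>
        by (simp add: E divide_right_mono)
      also have "\<dots> \<le> K * real r powr (\<alpha> - 1) / G"
        using K \<open>0 < G\<close> by (intro divide_right_mono mult_right_mono) auto
      also have "\<dots> = K / G * real r powr (\<alpha> - 1)" by simp
      also have "\<dots> \<le> C * real r powr (\<alpha> - 1)"
        using C by (intro mult_right_mono) auto
      finally show ?thesis .
    qed
    have later: "E \<le> K * (real n powr (\<alpha> - 1) * real M powr \<alpha>) / G" if "1 \<le> n"
      using later_interval_error_le[OF \<open>0 < H\<close> _ that _ h(1) t \<open>t \<le> T\<close>] idx \<open>0 < G\<close>
      by (simp add: E K_def divide_right_mono)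
    show "E \<le> C * (if n = 0 \<and> r = 1 then 1
                    else if n = 0 then h powr (1 - \<alpha>) * fine_node T N\<^sub>t M 0 r powr (\<alpha> - 1)
                    else if n = 1 then real M powr \<alpha> / Gamma (1 - \<alpha>)
                    else h powr (1 - \<alpha>) * coarse_node T N\<^sub>t n powr (\<alpha> - 1) * real M powr (\<alpha> + 1))"
      unfolding G_def[symmetric]
    proof -
      consider "n = 0" "r = 1" | "n = 0" "r \<noteq> 1" | "n = 1" | "2 \<le> n" by linarith
      then show "E \<le> C * (if n = 0 \<and> r = 1 then 1
                    else if n = 0 then h powr (1 - \<alpha>) * fine_node T N\<^sub>t M 0 r powr (\<alpha> - 1)
                    else if n = 1 then real M powr \<alpha> / G
                    else h powr (1 - \<alpha>) * coarse_node T N\<^sub>t n powr (\<alpha> - 1) * real M powr (\<alpha> + 1))"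
      proof cases
        case 1
        then show ?thesis using first by simp
      next
        case 2
        have "h powr (1 - \<alpha>) * h powr (\<alpha> - 1) = 1"
          using h(2) by (simp add: powr_add[symmetric])
        then have "h powr (1 - \<alpha>) * fine_node T N\<^sub>t M 0 r powr (\<alpha> - 1) = real r powr (\<alpha> - 1)"
          using h(2) by (simp add: fine_node_def coarse_node_def h_def[symmetric] powr_mult)
        then show ?thesis using 2 first by simp
      next
        case 3
        then have "E \<le> K * (real M powr \<alpha> / G)" using later by simp
        also have "\<dots> \<le> C * (real M powr \<alpha> / G)"
          using C \<open>0 < G\<close> by (intro mult_right_mono) auto
        finally show ?thesis using 3 by simp
      next
        case 4
        have "h powr (1 - \<alpha>) * coarse_node T N\<^sub>t n powr (\<alpha> - 1) * real M powr (\<alpha> + 1)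
            = real n powr (\<alpha> - 1) * (real M powr (\<alpha> - 1) * real M powr (\<alpha> + 1))"
          using \<open>0 < H\<close> idx
          by (simp add: h coarse_node_def H_def[symmetric] powr_mult powr_divide powr_diff powr_minus divide_simps)
        also have "real M powr (\<alpha> - 1) * real M powr (\<alpha> + 1) = real M powr (2 * \<alpha>)"
          by (simp add: powr_add[symmetric])
        finally have eq: "h powr (1 - \<alpha>) * coarse_node T N\<^sub>t n powr (\<alpha> - 1) * real M powr (\<alpha> + 1)
            = real n powr (\<alpha> - 1) * real M powr (2 * \<alpha>)" .
        have "E \<le> K / G * (real n powr (\<alpha> - 1) * real M powr \<alpha>)"
          using later 4 by simp
        also have "\<dots> \<le> C * (real n powr (\<alpha> - 1) * real M powr (2 * \<alpha>))"
          using C idx assms by (intro mult_mono mult_left_mono powr_mono) auto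
        finally show ?thesis using 4 by (simp add: eq)
      qed
    qed
  qed (rule C)
qed

end
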